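(* For every $\epsilon>0$ there exists $\gamma>0$ such that a random graph $G\sim G\left(n,\frac{1+\epsilon}{n}\right)$ contains with high probability an induced bounded degree $\gamma$-expander on at least $\gamma n$ vertices.
   Context: $G(n,p)$ is the binomial random graph on $n$ labelled vertices in which each pair of vertices is an edge independently with probability $p$. "With high probability" means with probability tending to $1$ as $n\to\infty$. "Induced" means that the expander is an induced subgraph of $G$; "bounded degree" means that its maximum degree is at most a constant depending only on $\epsilon$ (not on $n$). For a graph $H=(U,F)$ and $W\subset U$, the external neighborhood is $N_H(W)=\{v\in U\setminus W: v \text{ has a neighbor in } W\}$. For $\gamma>0$, a graph $H=(U,F)$ on $m$ vertices is a $\gamma$-expander if $|N_H(W)|\ge \gamma|W|$ for every $W\subset U$ with $|W|\le m/2$. *)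

theory Defs
  imports "HOL-Probability.Probability"
begin

text \<open>A graph is a pair of a vertex set and a set of edges, an edge being an unordered pair of
  distinct vertices.\<close>

type_synonym 'a ugraph = "'a set \<times> 'a set set"

abbreviation verts :: "'a ugraph \<Rightarrow> 'a set" where
  "verts H \<equiv> fst H"

abbreviation edges :: "'a ugraph \<Rightarrow> 'a set set" where
  "edges H \<equiv> snd H"

definition all_pairs :: "'a set \<Rightarrow> 'a set set" where
  "all_pairs V = {e. e \<subseteq> V \<and> card e = 2}"

definition simple_graph :: "'a ugraph \<Rightarrow> bool" where
  "simple_graph H \<longleftrightarrow> finite (verts H) \<and> edges H \<subseteq> all_pairs (verts H)"

definition induced_subgraph :: "'a ugraph \<Rightarrow> 'a ugraph \<Rightarrow> bool" where
  "induced_subgraph H G \<longleftrightarrow> verts H \<subseteq> verts G \<and> edges H = {e \<in> edges G. e \<subseteq> verts H}"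

definition nbhd :: "'a ugraph \<Rightarrow> 'a set \<Rightarrow> 'a set" where
  "nbhd H W = {v \<in> verts H - W. \<exists>w\<in>W. {v, w} \<in> edges H}"

definition vdegree :: "'a ugraph \<Rightarrow> 'a \<Rightarrow> nat" where
  "vdegree H v = card {w \<in> verts H. {v, w} \<in> edges H}"

definition max_degree_le :: "'a ugraph \<Rightarrow> nat \<Rightarrow> bool" where
  "max_degree_le H D \<longleftrightarrow> (\<forall>v\<in>verts H. vdegree H v \<le> D)"

definition expander :: "real \<Rightarrow> 'a ugraph \<Rightarrow> bool" where
  "expander \<gamma> H \<longleftrightarrow> simple_graph H \<and>
     (\<forall>W\<subseteq>verts H. real (card W) \<le> real (card (verts H)) / 2
        \<longrightarrow> real (card (nbhd H W)) \<ge> \<gamma> * real (card W))"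

text \<open>The binomial random graph on the vertex set \<open>{..<n}\<close>. The library truncates the parameter of
  \<open>bernoulli_pmf\<close> to the unit interval, so values of \<open>p\<close> above 1 are read as 1.\<close>

definition gnp :: "nat \<Rightarrow> real \<Rightarrow> nat ugraph pmf" where
  "gnp n p = map_pmf (\<lambda>c. ({..<n}, {e \<in> all_pairs {..<n}. c e}))
     (Pi_pmf (all_pairs {..<n}) False (\<lambda>_. bernoulli_pmf p))"

lemma gnp_simple_graph: "G \<in> set_pmf (gnp n p) \<Longrightarrow> simple_graph G"
  by (auto simp: gnp_def simple_graph_def)

end

(* A graph of bounded degree in which every small set of vertices spans few edges, and some set U
   spans at least (1 + d)|U| edges, contains an induced expander: take U maximising
   e(U)/|U| - m|U|/n. In G(n, c/n) with c > 1 three union bounds provide this situation. Local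
   sparsity is standard, and any mu n vertices meet few edges, so that the vertices of large
   degree can be dropped. For the dense set, fix the first i = eta n vertices as roots and let A be
   the set of vertices reachable from them. It carries a forest with |A| - i edges and sends no edge
   outside. The expected number of such configurations with |A| = x n is exp(n g(x)) up to
   small errors, where
     g(x) = -(1 - x) ln(1 - x) + x ln c - c x (1 - x)        if edges inside A are ignored,
     g(x) = the same minus c x^2 / 2                         if A has few edges besides the forest.
   The first is negative for small x > 0. The second is negative for all x > 0, as it vanishes at 0
   and has derivative ln y + 1 - y <= 0 with y = c (1 - x). Hence A is large and has linearly
   many edges more than |A|. *)

theory Submission
  imports Defs "HOL-Real_Asymp.Real_Asymp"
begin

section \<open>Expanders in locally sparse graphs\<close>

definition edges_within :: "'a set set \<Rightarrow> 'a set \<Rightarrow> 'a set set" where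
  "edges_within E U = {e \<in> E. e \<subseteq> U}"

lemma finite_all_pairs [simp]: "finite V \<Longrightarrow> finite (all_pairs V)"
  unfolding all_pairs_def by simp

lemma all_pairs_mono: "U \<subseteq> V \<Longrightarrow> all_pairs U \<subseteq> all_pairs V"
  unfolding all_pairs_def by blast

lemma card_all_pairs: "finite V \<Longrightarrow> card (all_pairs V) = card V choose 2"
  unfolding all_pairs_def by (rule n_subsets)

text \<open>An edge inside \<open>U\<close> with exactly one end in \<open>W\<close> has its other
  end in the external neighborhood of \<open>W\<close>, and each vertex there lies on at most
  \<open>D\<close> edges. All remaining edges inside \<open>U\<close> lie within \<open>W\<close> or
  within \<open>U - W\<close>.\<close>

lemma card_edges_cut_le:
  assumes fin: "finite U" and E: "E \<subseteq> all_pairs V" and UV: "U \<subseteq> V" "finite V"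
    and W: "W \<subseteq> U" and D: "\<And>v. v \<in> U \<Longrightarrow> card {w \<in> V. {v, w} \<in> E} \<le> D"
  shows "card (edges_within E U) \<le> card (edges_within E W) + card (edges_within E (U - W))
           + D * card (nbhd (U, edges_within E U) W)"
proof -
  let ?N = "nbhd (U, edges_within E U) W"
  let ?C = "\<Union>v\<in>?N. (\<lambda>w. {v, w}) ` {w \<in> V. {v, w} \<in> E}"
  have NU: "?N \<subseteq> U" by (auto simp: nbhd_def)
  have finN: "finite ?N" using NU fin finite_subset by blast
  have finE: "finite E" using E UV finite_all_pairs finite_subset by blast
  have "edges_within E U \<subseteq> edges_within E W \<union> edges_within E (U - W) \<union> ?C"
  proof
    fix e assume e: "e \<in> edges_within E U"
    then have "e \<in> all_pairs V" "e \<in> E" "e \<subseteq> U" using E by (auto simp: edges_within_def)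
    then obtain x y where xy: "e = {x, y}" "x \<noteq> y"
      by (auto simp: all_pairs_def card_2_iff)
    have U: "x \<in> U" "y \<in> U" using xy \<open>e \<subseteq> U\<close> by auto
    consider "x \<in> W" "y \<in> W" | "x \<notin> W" "y \<notin> W" | "x \<in> W" "y \<notin> W" | "x \<notin> W" "y \<in> W" by blast
    then show "e \<in> edges_within E W \<union> edges_within E (U - W) \<union> ?C"
    proof cases
      case 1 then show ?thesis using xy \<open>e \<in> E\<close> by (auto simp: edges_within_def)
    next
      case 2 then show ?thesis using xy \<open>e \<in> E\<close> U by (auto simp: edges_within_def)
    next
      case 3
      have "{y, x} \<in> E" "{y, x} \<in> edges_within E U"
        using xy \<open>e \<in> E\<close> e by (simp_all add: insert_commute)
      with 3 U UV have y: "y \<in> ?N" and x: "x \<in> {w \<in> V. {y, w} \<in> E}"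
        by (auto simp: nbhd_def)
      have "{y, x} \<in> ?C" by (rule UN_I[OF y], rule imageI[OF x])
      then show ?thesis using xy(1) by (simp add: insert_commute)
    next
      case 4
      have "{x, y} \<in> E" "{x, y} \<in> edges_within E U"
        using xy \<open>e \<in> E\<close> e by simp_all
      with 4 U UV have x: "x \<in> ?N" and y: "y \<in> {w \<in> V. {x, w} \<in> E}"
        by (auto simp: nbhd_def)
      have "{x, y} \<in> ?C" by (rule UN_I[OF x], rule imageI[OF y])
      then show ?thesis using xy(1) by simp
    qed
  qed
  moreover have "finite (edges_within E W \<union> edges_within E (U - W) \<union> ?C)"
    using finE finN UV by (auto simp: edges_within_def)
  ultimately have "card (edges_within E U) \<le> card (edges_within E W \<union> edges_within E (U - W) \<union> ?C)"
    by (rule card_mono[rotated])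
  also have "\<dots> \<le> card (edges_within E W) + card (edges_within E (U - W)) + card ?C"
    by (meson add_mono card_Un_le le_refl order_trans)
  also have "card ?C \<le> (\<Sum>v\<in>?N. card ((\<lambda>w. {v, w}) ` {w \<in> V. {v, w} \<in> E}))"
    by (rule card_UN_le[OF finN])
  also have "\<dots> \<le> (\<Sum>v\<in>?N. D)"
  proof (rule sum_mono)
    fix v assume "v \<in> ?N"
    then have "card {w \<in> V. {v, w} \<in> E} \<le> D" using D NU by blast
    moreover have "card ((\<lambda>w. {v, w}) ` {w \<in> V. {v, w} \<in> E}) \<le> card {w \<in> V. {v, w} \<in> E}"
      by (rule card_image_le) (use UV in auto)
    ultimately show "card ((\<lambda>w. {v, w}) ` {w \<in> V. {v, w} \<in> E}) \<le> D" by linarith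
  qed
  finally show ?thesis by (simp add: mult.commute)
qed

text \<open>The expander is the set \<open>U\<close> maximising \<open>e(U) / |U| - \<mu> |U| / n\<close>. Comparing \<open>U\<close> with the two parts
  of a partition into sets of size \<open>a\<close> and \<open>b\<close> leaves at least
  \<open>\<mu> ((a + b)\<^sup>2 - a\<^sup>2 - b\<^sup>2) / n = 2 \<mu> a b / n\<close> edges between the parts; local sparsity makes \<open>U\<close> large.\<close>

lemma expander_of_locally_sparse:
  fixes \<mu> \<alpha> :: real
  assumes V: "finite V" "V \<noteq> {}" and E: "E \<subseteq> all_pairs V" and XV: "X \<subseteq> V"
    and deg: "\<And>v. v \<in> X \<Longrightarrow> card {w \<in> V. {v, w} \<in> E} \<le> D" and D: "D > 0"
    and pos: "\<mu> > 0" "\<alpha> > 0"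
    and U0: "U0 \<subseteq> X" "U0 \<noteq> {}" "real (card (edges_within E U0)) \<ge> (1 + 2 * \<mu>) * card U0"
    and sparse: "\<And>W. W \<subseteq> V \<Longrightarrow> W \<noteq> {} \<Longrightarrow> real (card W) \<le> \<alpha> * card V \<Longrightarrow>
       real (card (edges_within E W)) < (1 + \<mu>) * card W"
  shows "\<exists>H. induced_subgraph H (V, E) \<and> max_degree_le H D \<and> expander (\<mu> * \<alpha> / D) H
           \<and> real (card (verts H)) \<ge> \<alpha> * card V"
proof -
  let ?n = "real (card V)"
  let ?e = "\<lambda>U. real (card (edges_within E U))"
  define \<phi> where "\<phi> U = ?e U / card U - \<mu> * card U / ?n" for U
  have n: "?n > 0" using V by (simp add: card_gt_0_iff)
  have finX: "finite X" using XV V finite_subset by blast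
  let ?F = "Pow X - {{}}"
  have F: "finite ?F" "?F \<noteq> {}" using finX U0 by auto
  obtain U where U: "U \<in> ?F" and max: "\<And>W. W \<in> ?F \<Longrightarrow> \<phi> W \<le> \<phi> U"
  proof -
    have "Max (\<phi> ` ?F) \<in> \<phi> ` ?F" using F by (intro Max_in) auto
    then obtain U where "U \<in> ?F" "Max (\<phi> ` ?F) = \<phi> U" by (elim imageE)
    moreover have "\<phi> W \<le> Max (\<phi> ` ?F)" if "W \<in> ?F" for W using F that by (intro Max_ge) auto
    ultimately show ?thesis using that by metis
  qed
  have UX: "U \<subseteq> X" and Une: "U \<noteq> {}" and UV: "U \<subseteq> V" and finU: "finite U"
    using U XV finX finite_subset by auto
  have cU: "real (card U) > 0" using Une finU by (simp add: card_gt_0_iff)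
  \<comment> \<open>Maximality of \<open>U\<close> as an upper bound on the number of edges in
    \<open>W\<close>. The product form also holds for the empty set, which can occur as one of the
    two parts of a partition and where the quotient in \<open>\<phi>\<close> says nothing.\<close>
  have upper: "?e W \<le> card W * (\<phi> U + \<mu> * card W / ?n)" if "W \<subseteq> X" for W
  proof (cases "W = {}")
    case True
    have "edges_within E {} = {}" using E by (auto simp: edges_within_def all_pairs_def)
    then show ?thesis using True by simp
  next
    case False
    have "real (card W) > 0" using False that finX finite_subset by (fastforce simp: card_gt_0_iff)
    moreover have "\<phi> W \<le> \<phi> U" using max that False by auto
    ultimately show ?thesis unfolding \<phi>_def[of W] by (simp add: field_simps)
  qed
  have eU: "?e U = card U * (\<phi> U + \<mu> * card U / ?n)"
    unfolding \<phi>_def using cU by (simp add: field_simps)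
  have cU0: "real (card U0) > 0" using U0 finX finite_subset by (fastforce simp: card_gt_0_iff)
  \<comment> \<open>The penalty of \<open>U0\<close> is at most \<open>\<mu>\<close>, as
    \<open>U0\<close> has at most \<open>card V\<close> vertices, so half of the excess
    \<open>2 * \<mu>\<close> survives in \<open>\<phi> U\<close>. The penalty of \<open>U\<close> is
    nonnegative, so \<open>U\<close> itself has density at least \<open>1 + \<mu>\<close> and is too
    dense to be a small set.\<close>
  have "\<phi> U \<ge> \<phi> U0" using max U0 by auto
  moreover have "?e U0 / card U0 \<ge> 1 + 2 * \<mu>" using U0(3) cU0 by (simp add: field_simps)
  moreover have "\<mu> * card U0 / ?n \<le> \<mu>"
    using pos n U0 XV V by (simp add: field_simps card_mono)
  ultimately have \<phi>U: "\<phi> U \<ge> 1 + \<mu>" unfolding \<phi>_def[of U0] by linarith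
  have "\<mu> * card U / ?n \<ge> 0" using pos by simp
  then have "?e U \<ge> (1 + \<mu>) * card U"
    unfolding eU using \<phi>U cU by (simp add: mult.commute)
  then have big: "real (card U) > \<alpha> * ?n" using sparse[OF UV Une] by fastforce
  let ?H = "(U, edges_within E U)"
  have "induced_subgraph ?H (V, E)"
    using UV by (auto simp: induced_subgraph_def edges_within_def)
  moreover have "max_degree_le ?H D"
    unfolding max_degree_le_def
  proof
    fix v assume v: "v \<in> verts ?H"
    have "vdegree ?H v \<le> card {w \<in> V. {v, w} \<in> E}"
      unfolding vdegree_def by (rule card_mono) (use V UV in \<open>auto simp: edges_within_def\<close>)
    then show "vdegree ?H v \<le> D" using deg[of v] v UX by auto
  qed
  moreover have "expander (\<mu> * \<alpha> / D) ?H"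
    unfolding expander_def
  proof (intro conjI allI impI)
    show "simple_graph ?H"
      using finU E by (auto simp: simple_graph_def edges_within_def all_pairs_def)
    fix W assume "W \<subseteq> verts ?H" and half: "real (card W) \<le> real (card (verts ?H)) / 2"
    then have WU: "W \<subseteq> U" by simp
    let ?a = "real (card W)" and ?b = "real (card (U - W))"
    have ab: "real (card U) = ?a + ?b"
      using WU finU by (simp add: card_Diff_subset card_mono finite_subset of_nat_diff)
    have "?e U \<le> ?e W + ?e (U - W) + D * real (card (nbhd ?H W))"
      using card_edges_cut_le[OF finU E UV V(1) WU, of D] deg UX
      by (metis (no_types, lifting) of_nat_add of_nat_le_iff of_nat_mult subsetD)
    moreover have "?e W \<le> ?a * (\<phi> U + \<mu> * ?a / ?n)" using upper WU UX by auto
    moreover have "?e (U - W) \<le> ?b * (\<phi> U + \<mu> * ?b / ?n)" using upper[of "U - W"] UX by blast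
    ultimately have "(?a + ?b) * (\<phi> U + \<mu> * (?a + ?b) / ?n) - ?a * (\<phi> U + \<mu> * ?a / ?n)
        - ?b * (\<phi> U + \<mu> * ?b / ?n) \<le> D * real (card (nbhd ?H W))"
      unfolding eU ab by linarith
    moreover have "(?a + ?b) * (\<phi> U + \<mu> * (?a + ?b) / ?n) - ?a * (\<phi> U + \<mu> * ?a / ?n)
        - ?b * (\<phi> U + \<mu> * ?b / ?n) = \<mu> * ?a * ((2 * ?b) / ?n)"
      using n by (simp add: field_simps)
    \<comment> \<open>Since \<open>W\<close> is at most half of \<open>U\<close>, the other part
      contains at least half of the more than \<open>\<alpha> * ?n\<close> vertices of
      \<open>U\<close>.\<close>
    moreover have "\<mu> * ?a * ((2 * ?b) / ?n) \<ge> \<mu> * ?a * \<alpha>"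
    proof (rule mult_left_mono)
      have "2 * ?b \<ge> \<alpha> * ?n" using half ab big by simp
      then show "\<alpha> \<le> 2 * ?b / ?n" using n by (simp add: field_simps)
    qed (use pos in simp)
    ultimately show "\<mu> * \<alpha> / D * card W \<le> card (nbhd ?H W)"
      using D by (simp add: field_simps)
  qed
  ultimately show ?thesis using big by (intro exI[of _ ?H]) auto
qed

section \<open>Exponential moments in the binomial random graph\<close>

lemma set_pmf_gnpE:
  assumes "G \<in> set_pmf (gnp n p)"
  obtains E where "E \<subseteq> all_pairs {..<n}" "G = ({..<n}, E)"
  using assms that[of "edges G"] by (auto simp: gnp_def)

text \<open>Markov's inequality for a product weight: the pairs are independent, so the expectation
  of the product is the product of the expectations. The choice of \<open>w\<close> yields both the
  exact cost of prescribed edges and Chernoff bounds.\<close>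

lemma gnp_prob_le_weight:
  fixes w :: "nat set \<Rightarrow> bool \<Rightarrow> real"
  assumes p: "0 \<le> p" "p \<le> 1" and w: "\<And>e b. w e b \<ge> 0" and K: "K > 0"
    and X: "\<And>E. E \<subseteq> all_pairs {..<n} \<Longrightarrow> ({..<n}, E) \<in> X \<Longrightarrow>
              K \<le> (\<Prod>e\<in>all_pairs {..<n}. w e (e \<in> E))"
  shows "measure_pmf.prob (gnp n p) X
           \<le> (\<Prod>e\<in>all_pairs {..<n}. p * w e True + (1 - p) * w e False) / K"
proof -
  let ?A = "all_pairs {..<n}"
  let ?P = "Pi_pmf ?A False (\<lambda>_. bernoulli_pmf p)"
  let ?f = "\<lambda>c. ({..<n}, {e \<in> ?A. c e})"
  let ?g = "\<lambda>c. (\<Prod>e\<in>?A. w e (c e))"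
  have int: "integrable (measure_pmf ?P) ?g"
    by (rule integrable_prod_Pi_pmf) (auto intro: integrable_measure_pmf_finite)
  have "measure_pmf.prob (gnp n p) X = measure_pmf.prob ?P (?f -` X)"
    unfolding gnp_def by (simp add: measure_map_pmf)
  also have "\<dots> = measure_pmf.expectation ?P (indicator (?f -` X))" by simp
  also have "\<dots> \<le> measure_pmf.expectation ?P (\<lambda>c. ?g c / K)"
  proof (rule integral_mono_AE)
    show "integrable (measure_pmf ?P) (indicator (?f -` X) :: _ \<Rightarrow> real)"
      by (intro measure_pmf.integrable_const_bound[where B = 1]) (auto simp: indicator_def)
    show "integrable (measure_pmf ?P) (\<lambda>c. ?g c / K)" using int by simp
    show "AE c in measure_pmf ?P. indicator (?f -` X) c \<le> ?g c / K"
    proof (rule AE_pmfI)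
      fix c
      show "indicator (?f -` X) c \<le> ?g c / K"
      proof (cases "?f c \<in> X")
        case True
        then have "K \<le> (\<Prod>e\<in>?A. w e (e \<in> {e \<in> ?A. c e}))" by (intro X) auto
        also have "\<dots> = ?g c" by (intro prod.cong) auto
        finally show ?thesis using True K by (simp add: field_simps)
      qed (use w K in \<open>auto intro!: divide_nonneg_pos prod_nonneg\<close>)
    qed
  qed
  also have "\<dots> = measure_pmf.expectation ?P ?g / K" by simp
  also have "measure_pmf.expectation ?P ?g
      = (\<Prod>e\<in>?A. measure_pmf.expectation (bernoulli_pmf p) (w e))"
    by (rule expectation_prod_Pi_pmf) (auto intro: integrable_measure_pmf_finite w)
  also have "\<dots> = (\<Prod>e\<in>?A. p * w e True + (1 - p) * w e False)"
    using p by (intro prod.cong) (auto simp: mult.commute)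
  finally show ?thesis .
qed

text \<open>The weight is 0 unless all of \<open>F\<close> is present and all of \<open>N\<close> is
  absent, and it is multiplied by \<open>z\<close> for each edge in \<open>M\<close>; on the event
  it is at least \<open>z powr q\<close> because \<open>z \<le> 1\<close>. The cost of
  \<open>F\<close> stays exact, while \<open>1 - y \<le> exp (- y)\<close> handles \<open>N\<close>
  and \<open>M\<close>. With \<open>z = 1\<close> the bound ignores \<open>M\<close>.\<close>

lemma gnp_prob_pattern_le:
  fixes z q :: real
  assumes p: "0 \<le> p" "p \<le> 1" and z: "0 < z" "z \<le> 1"
    and sub: "F \<subseteq> all_pairs {..<n}" "N \<subseteq> all_pairs {..<n}" "M \<subseteq> all_pairs {..<n}"
    and disj: "F \<inter> N = {}" "F \<inter> M = {}" "N \<inter> M = {}"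
  shows "measure_pmf.prob (gnp n p)
           {G. F \<subseteq> edges G \<and> N \<inter> edges G = {} \<and> real (card (M \<inter> edges G)) \<le> q}
         \<le> p ^ card F * exp (- p * card N) * exp (- p * (1 - z) * card M) / z powr q"
proof -
  let ?A = "all_pairs {..<n}"
  define w :: "nat set \<Rightarrow> bool \<Rightarrow> real" where
    "w e b = (if e \<in> F then of_bool b else 1) * (if e \<in> N then of_bool (\<not> b) else 1)
             * (if e \<in> M \<and> b then z else 1)" for e b
  have fin: "finite ?A" by simp
  have If: "(\<Prod>e\<in>?A. if e \<in> S then x else 1) = x ^ card S" if "S \<subseteq> ?A" for S and x :: real
    using that fin by (simp add: prod.If_cases Int_absorb1)
  have "measure_pmf.prob (gnp n p)
           {G. F \<subseteq> edges G \<and> N \<inter> edges G = {} \<and> real (card (M \<inter> edges G)) \<le> q}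
     \<le> (\<Prod>e\<in>?A. p * w e True + (1 - p) * w e False) / z powr q"
  proof (rule gnp_prob_le_weight[OF p])
    show "w e b \<ge> 0" for e b using z by (auto simp: w_def)
    show "z powr q > 0" using z by simp
    fix E assume E: "E \<subseteq> ?A"
      "({..<n}, E) \<in> {G. F \<subseteq> edges G \<and> N \<inter> edges G = {} \<and> real (card (M \<inter> edges G)) \<le> q}"
    have "(\<Prod>e\<in>?A. w e (e \<in> E)) = (\<Prod>e\<in>?A. if e \<in> M \<inter> E then z else 1)"
      using E by (intro prod.cong) (auto simp: w_def)
    also have "\<dots> = z ^ card (M \<inter> E)" by (rule If) (use sub in auto)
    also have "\<dots> = z powr real (card (M \<inter> E))" using z by (simp add: powr_realpow)
    also have "\<dots> \<ge> z powr q" using E z by (intro powr_mono') auto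
    finally show "z powr q \<le> (\<Prod>e\<in>?A. w e (e \<in> E))" .
  qed
  also have "(\<Prod>e\<in>?A. p * w e True + (1 - p) * w e False)
     = (\<Prod>e\<in>?A. (if e \<in> F then p else 1) * (if e \<in> N then 1 - p else 1)
          * (if e \<in> M then 1 - p * (1 - z) else 1))"
    using disj by (intro prod.cong) (auto simp: w_def algebra_simps)
  also have "\<dots> = p ^ card F * (1 - p) ^ card N * (1 - p * (1 - z)) ^ card M"
    using sub by (simp add: prod.distrib If)
  also have "\<dots> \<le> p ^ card F * exp (- p) ^ card N * exp (- (p * (1 - z))) ^ card M"
  proof -
    have "1 - p \<le> exp (- p)" "1 - p * (1 - z) \<le> exp (- (p * (1 - z)))"
      using exp_ge_add_one_self[of "- p"] exp_ge_add_one_self[of "- (p * (1 - z))"] by simp_all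
    moreover have "p * (1 - z) \<le> 1 * 1" using p z by (intro mult_mono) auto
    ultimately show ?thesis using p by (intro mult_mono power_mono mult_nonneg_nonneg) auto
  qed
  also have "\<dots> = p ^ card F * exp (- p * card N) * exp (- p * (1 - z) * card M)"
    by (simp add: exp_of_nat_mult[symmetric] mult_ac)
  finally show ?thesis using z by (simp add: divide_right_mono)
qed

text \<open>The upper-tail counterpart, with a tilt \<open>z \<ge> 1\<close>. Each pair of
  \<open>M\<close> contributes \<open>1 + p * (z - 1)\<close>, which is bounded crudely by
  \<open>exp (p * z)\<close>.\<close>

lemma gnp_prob_many_edges_le:
  fixes z q :: real
  assumes p: "0 \<le> p" "p \<le> 1" and z: "1 \<le> z" and sub: "M \<subseteq> all_pairs {..<n}"
  shows "measure_pmf.prob (gnp n p) {G. real (card (M \<inter> edges G)) \<ge> q}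
         \<le> exp (p * z * card M) / z powr q"
proof -
  let ?A = "all_pairs {..<n}"
  define w :: "nat set \<Rightarrow> bool \<Rightarrow> real" where "w e b = (if e \<in> M \<and> b then z else 1)" for e b
  have fin: "finite ?A" by simp
  have If: "(\<Prod>e\<in>?A. if e \<in> S then x else 1) = x ^ card S" if "S \<subseteq> ?A" for S and x :: real
    using that fin by (simp add: prod.If_cases Int_absorb1)
  have "measure_pmf.prob (gnp n p) {G. real (card (M \<inter> edges G)) \<ge> q}
     \<le> (\<Prod>e\<in>?A. p * w e True + (1 - p) * w e False) / z powr q"
  proof (rule gnp_prob_le_weight[OF p])
    show "w e b \<ge> 0" for e b using z by (auto simp: w_def)
    show "z powr q > 0" using z by simp
    fix E assume E: "E \<subseteq> ?A" "({..<n}, E) \<in> {G. real (card (M \<inter> edges G)) \<ge> q}"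
    have "(\<Prod>e\<in>?A. w e (e \<in> E)) = (\<Prod>e\<in>?A. if e \<in> M \<inter> E then z else 1)"
      using E by (intro prod.cong) (auto simp: w_def)
    also have "\<dots> = z ^ card (M \<inter> E)" by (rule If) (use sub in auto)
    also have "\<dots> = z powr real (card (M \<inter> E))" using z by (simp add: powr_realpow)
    also have "\<dots> \<ge> z powr q" using E z by (intro powr_mono) auto
    finally show "z powr q \<le> (\<Prod>e\<in>?A. w e (e \<in> E))" .
  qed
  also have "(\<Prod>e\<in>?A. p * w e True + (1 - p) * w e False)
     = (\<Prod>e\<in>?A. if e \<in> M then p * z + (1 - p) else 1)"
    by (intro prod.cong) (auto simp: w_def)
  also have "\<dots> = (p * z + (1 - p)) ^ card M" by (rule If[OF sub])
  also have "\<dots> \<le> exp (p * z) ^ card M"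
  proof (rule power_mono)
    show "p * z + (1 - p) \<le> exp (p * z)" using exp_ge_add_one_self[of "p * z"] p by linarith
    show "0 \<le> p * z + (1 - p)" using p z by simp
  qed
  also have "\<dots> = exp (p * z * card M)" by (simp add: exp_of_nat_mult[symmetric] mult_ac)
  finally show ?thesis using z by (simp add: divide_right_mono)
qed

text \<open>The covering is required only for graphs in the support. The event \<open>X\<close> may
  contain other pairs of sets as well, so the comparison of events is an almost sure one.\<close>

lemma gnp_union_bound:
  assumes I: "finite I"
    and X: "\<And>E. E \<subseteq> all_pairs {..<n} \<Longrightarrow> ({..<n}, E) \<in> X \<Longrightarrow> \<exists>i\<in>I. ({..<n}, E) \<in> Y i"
    and B: "\<And>i. i \<in> I \<Longrightarrow> measure_pmf.prob (gnp n p) (Y i) \<le> B i"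
  shows "measure_pmf.prob (gnp n p) X \<le> sum B I"
proof -
  have "measure_pmf.prob (gnp n p) X \<le> measure_pmf.prob (gnp n p) (\<Union>i\<in>I. Y i)"
    by (intro measure_pmf.finite_measure_mono_AE AE_pmfI) (auto elim!: set_pmf_gnpE dest: X)
  also have "\<dots> \<le> (\<Sum>i\<in>I. measure_pmf.prob (gnp n p) (Y i))"
    by (intro measure_pmf.finite_measure_subadditive_finite I) auto
  also have "\<dots> \<le> sum B I" by (intro sum_mono B)
  finally show ?thesis .
qed

section \<open>Sparsity of small sets\<close>

lemma power_le_fact_mult_exp:
  assumes "x \<ge> (0::real)" shows "x ^ k \<le> fact k * exp x"
proof -
  have "(\<Sum>i\<in>{k}. x ^ i /\<^sub>R fact i) \<le> (\<Sum>i. x ^ i /\<^sub>R fact i)"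
    by (rule sum_le_suminf[OF summable_exp_generic]) (use assms in auto)
  then show ?thesis by (simp add: exp_def divide_simps mult.commute)
qed

text \<open>Combines \<open>n choose k \<le> n^k / k!\<close> with
  \<open>k^k \<le> k! * exp k\<close>, where the latter keeps a single term of the exponential
  series at \<open>k\<close>.\<close>

lemma binomial_le_exp_power:
  assumes "k > 0"
  shows "real (n choose k) \<le> (exp 1 * real n / real k) ^ k"
proof -
  have "real (n choose k) * fact k \<le> real n ^ k"
    using binomial_fact_pow[of n k] by (metis of_nat_fact of_nat_le_iff of_nat_mult of_nat_power)
  then have "real (n choose k) * (fact k * exp (real k)) \<le> real n ^ k * exp (real k)"
    by (simp add: mult.assoc[symmetric])
  moreover have "real (n choose k) * real k ^ k \<le> real (n choose k) * (fact k * exp (real k))"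
    by (intro mult_left_mono power_le_fact_mult_exp) auto
  ultimately have "real (n choose k) * real k ^ k \<le> real n ^ k * exp (real k)" by linarith
  also have "exp (real k) = exp 1 ^ k" by (simp add: exp_of_nat_mult[symmetric])
  finally show ?thesis using assms by (simp add: field_simps power_mult_distrib power_divide)
qed

lemma sum_over_power2_le: "(\<Sum>k=1..N. real k / 2 ^ k) \<le> 2"
proof -
  have "(\<Sum>k=1..N. real k / 2 ^ k) = 2 - (real N + 2) / 2 ^ N"
    by (induction N) (auto simp: field_simps)
  then show ?thesis by simp
qed

lemma edges_within_eq: "E \<subseteq> all_pairs V \<Longrightarrow> edges_within E W = all_pairs W \<inter> E"
  by (auto simp: edges_within_def all_pairs_def)

lemma tendsto_zero_prob:
  fixes b :: "nat \<Rightarrow> real"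
  assumes "\<forall>\<^sub>F n in sequentially. measure_pmf.prob (M n) (X n) \<le> b n" "b \<longlonglongrightarrow> 0"
  shows "(\<lambda>n. measure_pmf.prob (M n) (X n)) \<longlonglongrightarrow> 0"
  by (rule tendsto_sandwich[OF _ assms(1) tendsto_const assms(2)]) simp

text \<open>A union bound over the sets of size \<open>k = x * n\<close> gives at most
  \<open>(K * x powr d) ^ k\<close>: the \<open>k\<close> excess edges per set of size
  \<open>k\<close> cancel the entropy \<open>(exp 1 / x) ^ k\<close>, and the further
  \<open>d * k\<close> edges leave a positive power of \<open>x\<close>.\<close>

lemma gnp_locally_sparse:
  fixes c d :: real
  assumes c: "c > 0" and d: "0 < d" "d \<le> 1"
  shows "\<exists>\<alpha>>0. (\<lambda>n. measure_pmf.prob (gnp n (c / n))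
           {G. \<exists>W\<subseteq>verts G. W \<noteq> {} \<and> real (card W) \<le> \<alpha> * real n \<and>
                real (card (edges_within (edges G) W)) \<ge> (1 + d) * card W}) \<longlonglongrightarrow> 0"
proof -
  define K where "K = exp (1 + c)"
  have K: "K > 0" by (simp add: K_def)
  \<comment> \<open>Solves \<open>K * \<alpha> powr d \<le> 1 / 4\<close>, so that the base of the
    power stays below 1/2 with a factor 2 to spare.\<close>
  define \<alpha> where "\<alpha> = min 1 ((1 / (4 * K)) powr (1 / d))"
  have \<alpha>: "\<alpha> > 0" "\<alpha> \<le> 1" using K by (auto simp: \<alpha>_def)
  have K\<alpha>: "K * x powr d \<le> 1 / 4" if "0 \<le> x" "x \<le> \<alpha>" for x
  proof -
    have "x powr d \<le> ((1 / (4 * K)) powr (1 / d)) powr d"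
      using that d by (intro powr_mono2) (auto simp: \<alpha>_def)
    also have "\<dots> = 1 / (4 * K)" using d K by (simp add: powr_powr)
    finally show ?thesis using K by (simp add: field_simps)
  qed
  let ?Y = "\<lambda>W. {G. real (card (all_pairs W \<inter> edges G)) \<ge> (1 + d) * card W}"
  let ?X = "\<lambda>n. {G. \<exists>W\<subseteq>verts G. W \<noteq> {} \<and> real (card W) \<le> \<alpha> * real n \<and>
                real (card (edges_within (edges G) W)) \<ge> (1 + d) * card W}"
  have bound: "measure_pmf.prob (gnp n (c / n)) (?X n)
      \<le> 4 * K * n powr (- d)" (is "?P \<le> _") if n: "real n \<ge> c" for n
  proof -
    let ?I = "{k\<in>{1..n}. real k \<le> \<alpha> * n}"
    let ?p = "c / real n"
    have n0: "real n > 0" using n c by linarith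
    have p: "0 \<le> ?p" "?p \<le> 1" using n c by (auto simp: field_simps)
    have "?P \<le> (\<Sum>k\<in>?I. 2 * K * n powr (- d) * (k / 2 ^ k))"
    proof (rule gnp_union_bound[where Y = "\<lambda>k. \<Union>W\<in>{W. W \<subseteq> {..<n} \<and> card W = k}. ?Y W"], goal_cases)
      case 1 show ?case by simp
    next
      case (2 E)
      then obtain W where W: "W \<subseteq> {..<n}" "W \<noteq> {}" "real (card W) \<le> \<alpha> * n"
        "real (card (edges_within E W)) \<ge> (1 + d) * card W" by auto
      have "card W \<le> n" using card_mono[OF _ W(1)] by simp
      moreover have "card W > 0" using W finite_subset by (fastforce simp: card_gt_0_iff)
      ultimately show ?case using W 2(1)
        by (intro bexI[of _ "card W"]) (auto simp: edges_within_eq)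
    next
      case (3 k)
      then have k: "k > 0" "k \<le> n" "real k \<le> \<alpha> * n" by auto
      define x where "x = real k / n"
      have x: "x > 0" "x \<le> 1" "x \<le> \<alpha>" using k n0 \<alpha> by (auto simp: x_def field_simps intro: order_trans)
      have "measure_pmf.prob (gnp n ?p) (\<Union>W\<in>{W. W \<subseteq> {..<n} \<and> card W = k}. ?Y W)
         \<le> (\<Sum>W\<in>{W. W \<subseteq> {..<n} \<and> card W = k}. exp (c * k) * x powr ((1 + d) * k))"
      proof (rule gnp_union_bound[where Y = ?Y], goal_cases)
        case (3 W)
        then have W: "W \<subseteq> {..<n}" "card W = k" by auto
        have "finite W" using W finite_subset by blast
        then have "card (all_pairs W) \<le> k * k"
          using W binomial_le_pow[of 2 k] by (cases "k \<ge> 2")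
            (auto simp: card_all_pairs power2_eq_square binomial_eq_0)
        then have "real (card (all_pairs W)) \<le> real k * real k" by (metis of_nat_le_iff of_nat_mult)
        then have M: "?p * (1 / x) * card (all_pairs W) \<le> ?p * (1 / x) * (real k * real k)"
          using p x c by (intro mult_left_mono) auto
        \<comment> \<open>The mean number of edges in \<open>W\<close> is at most
          \<open>c * k * x\<close>, while the event asks for \<open>(1 + d) * k\<close>. The tilt
          \<open>1 / x\<close> matches this ratio up to constants and makes the exponential factor
          exactly \<open>exp (c * k)\<close>.\<close>
        have "measure_pmf.prob (gnp n ?p) (?Y W)
            \<le> exp (?p * (1 / x) * card (all_pairs W)) / (1 / x) powr ((1 + d) * card W)"
          by (rule gnp_prob_many_edges_le[OF p]) (use x W all_pairs_mono in auto)
        also have "\<dots> \<le> exp (?p * (1 / x) * (real k * real k)) / (1 / x) powr ((1 + d) * k)"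
          using M W by (simp add: divide_right_mono)
        also have "?p * (1 / x) * (real k * real k) = c * k" using n0 k by (simp add: x_def)
        also have "exp (c * k) / (1 / x) powr ((1 + d) * k) = exp (c * k) * x powr ((1 + d) * k)"
          using x by (simp add: powr_divide)
        finally show ?case .
      qed auto
      also have "\<dots> = real (n choose k) * (exp (c * k) * x powr ((1 + d) * k))"
        by (simp add: n_subsets)
      also have "\<dots> \<le> (exp 1 * real n / real k) ^ k * (exp (c * k) * x powr ((1 + d) * k))"
        by (intro mult_right_mono binomial_le_exp_power k) auto
      also have "\<dots> = (K * x powr d) ^ k"
      proof -
        have "exp 1 * real n / real k = exp 1 * (1 / x)" by (simp add: x_def)
        moreover have "exp (c * k) = exp c ^ k" by (simp add: exp_of_nat_mult[symmetric] mult.commute)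
        moreover have "x powr ((1 + d) * k) = (x * x powr d) ^ k"
          using x by (simp add: powr_powr[symmetric] powr_realpow powr_add)
        ultimately have "(exp 1 * real n / real k) ^ k * (exp (c * k) * x powr ((1 + d) * k))
            = (exp 1 * (1 / x) * (exp c * (x * x powr d))) ^ k"
          by (simp only: power_mult_distrib)
        also have "exp 1 * (1 / x) * (exp c * (x * x powr d)) = K * x powr d"
          using x by (simp add: K_def exp_add)
        finally show ?thesis .
      qed
      \<comment> \<open>Of the \<open>k\<close> factors \<open>2 * K * x powr d \<le> 1\<close> only
        one is kept. It provides the decay in \<open>n\<close>, which for bounded \<open>k\<close>
        cannot come from \<open>2 ^ k\<close>; the powers of 2 make the sum over \<open>k\<close>
        converge.\<close>
      also have "\<dots> \<le> 2 * (K * x powr d) / 2 ^ k"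
      proof -
        let ?y = "2 * (K * x powr d)"
        have "?y \<le> 1" using K\<alpha>[of x] x by simp
        then have "?y ^ k \<le> ?y ^ 1" using K x k by (intro power_decreasing) auto
        then show ?thesis by (simp add: power_mult_distrib field_simps)
      qed
      also have "\<dots> \<le> 2 * (K * (k * n powr (- d))) / 2 ^ k"
      proof -
        have "real k powr d \<le> real k powr 1" using k d by (intro powr_mono) auto
        then have "x powr d \<le> k * n powr (- d)"
          using k n0 by (simp add: x_def powr_divide powr_minus divide_simps)
        then show ?thesis using K by (intro divide_right_mono mult_left_mono) auto
      qed
      finally show ?case by (simp add: field_simps)
    qed
    also have "\<dots> \<le> (\<Sum>k=1..n. 2 * K * n powr (- d) * (k / 2 ^ k))"
      using K by (intro sum_mono2) auto
    also have "\<dots> = 2 * K * n powr (- d) * (\<Sum>k=1..n. k / 2 ^ k)"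
      by (simp add: sum_distrib_left)
    also have "\<dots> \<le> 2 * K * n powr (- d) * 2"
      using K by (intro mult_left_mono sum_over_power2_le) auto
    finally show ?thesis by simp
  qed
  have "\<forall>\<^sub>F n in sequentially. real n \<ge> c"
    using filterlim_real_sequentially by (auto simp: filterlim_at_top)
  then have "\<forall>\<^sub>F n in sequentially. measure_pmf.prob (gnp n (c / n)) (?X n) \<le> 4 * K * real n powr (- d)"
    by (rule eventually_mono) (rule bound)
  moreover have "(\<lambda>n. 4 * K * real n powr (- d)) \<longlonglongrightarrow> 0"
    using d by real_asymp
  ultimately have "(\<lambda>n. measure_pmf.prob (gnp n (c / n)) (?X n)) \<longlonglongrightarrow> 0"
    by (rule tendsto_zero_prob)
  then show ?thesis using \<alpha>(1) by blast
qed

text \<open>A set \<open>S\<close> meets at most \<open>card S * n\<close> pairs, so about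
  \<open>c * card S\<close> edges are expected there. This controls both how many vertices have
  large degree and how many edges are lost by deleting them. The \<open>+ 1\<close> leaves room for
  rounding a set size up to an integer.\<close>

lemma gnp_few_edges_at_small_sets:
  fixes c \<eta> :: real
  assumes c: "c > 0" and \<eta>: "\<eta> > 0"
  shows "\<exists>\<mu>>0. (\<lambda>n. measure_pmf.prob (gnp n (c / n))
           {G. \<exists>S\<subseteq>verts G. real (card S) \<le> \<mu> * real n + 1 \<and>
                real (card {e \<in> edges G. e \<inter> S \<noteq> {}}) \<ge> \<eta> * n}) \<longlonglongrightarrow> 0"
proof -
  \<comment> \<open>The tilt is chosen so that \<open>z powr (\<eta> * n) = exp (2 * n)\<close>, and
    then \<open>\<mu>\<close> so that the expectation costs only \<open>exp (n / 2 + c * z)\<close>.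
    The remaining \<open>exp (c * z - 3 * n / 2)\<close> beats the at most \<open>2 ^ n\<close>
    choices of the set.\<close>
  define z where "z = exp (2 / \<eta>)"
  have z: "z \<ge> 1" using \<eta> by (simp add: z_def)
  define \<mu> where "\<mu> = 1 / (2 * c * z)"
  have \<mu>: "\<mu> > 0" using c z by (simp add: \<mu>_def)
  let ?X = "\<lambda>n. {G. \<exists>S\<subseteq>verts G. real (card S) \<le> \<mu> * real n + 1 \<and>
                real (card {e \<in> edges G. e \<inter> S \<noteq> {}}) \<ge> \<eta> * n}"
  have bound: "measure_pmf.prob (gnp n (c / n)) (?X n)
      \<le> exp (c * z - n / 2)" (is "?P \<le> _") if n: "real n \<ge> c" for n
  proof -
    let ?I = "{S. S \<subseteq> {..<n} \<and> real (card S) \<le> \<mu> * n + 1}"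
    let ?M = "\<lambda>S. {e \<in> all_pairs {..<n}. e \<inter> S \<noteq> {}}"
    let ?p = "c / real n"
    have n0: "real n > 0" using n c by linarith
    have p: "0 \<le> ?p" "?p \<le> 1" using n c by (auto simp: field_simps)
    have "?P \<le> (\<Sum>S\<in>?I. exp (c * z - 3 * n / 2))"
    proof (rule gnp_union_bound[where Y = "\<lambda>S. {G. real (card (?M S \<inter> edges G)) \<ge> \<eta> * n}"], goal_cases)
      case 1 show ?case by simp
    next
      case (2 E)
      have "{e \<in> E. e \<inter> S \<noteq> {}} = ?M S \<inter> E" for S using 2(1) by auto
      then show ?case using 2 by auto
    next
      case (3 S)
      then have S: "S \<subseteq> {..<n}" "real (card S) \<le> \<mu> * n + 1" "finite S" using finite_subset by auto
      have "?M S \<subseteq> (\<lambda>(x, y). {x, y}) ` (S \<times> {..<n})"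
      proof
        fix e assume "e \<in> ?M S"
        then obtain x y where "e = {x, y}" "x \<in> S \<or> y \<in> S" "x < n" "y < n"
          by (auto simp: all_pairs_def card_2_iff)
        then show "e \<in> (\<lambda>(x, y). {x, y}) ` (S \<times> {..<n})"
          by (auto simp: image_iff insert_commute)
      qed
      then have "card (?M S) \<le> card (S \<times> {..<n})"
        using S by (meson card_image_le card_mono finite_SigmaI finite_imageI finite_lessThan order_trans)
      then have "real (card (?M S)) \<le> card S * real n"
        by (metis card_cartesian_product card_lessThan of_nat_le_iff of_nat_mult)
      then have "?p * z * card (?M S) \<le> ?p * z * (card S * real n)"
        using p z c by (intro mult_left_mono) auto
      also have "\<dots> = c * z * card S" using n0 by simp
      also have "\<dots> \<le> c * z * (\<mu> * n + 1)" using S c z by (intro mult_left_mono) auto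
      also have "\<dots> = n / 2 + c * z" using c z by (simp add: \<mu>_def field_simps)
      finally have M: "?p * z * card (?M S) \<le> n / 2 + c * z" .
      have "measure_pmf.prob (gnp n ?p) {G. real (card (?M S \<inter> edges G)) \<ge> \<eta> * n}
          \<le> exp (?p * z * card (?M S)) / z powr (\<eta> * n)"
        by (rule gnp_prob_many_edges_le[OF p z]) auto
      also have "\<dots> \<le> exp (n / 2 + c * z) / z powr (\<eta> * n)"
        using M by (simp add: divide_right_mono)
      also have "z powr (\<eta> * n) = exp (2 * n)" using \<eta> by (simp add: z_def powr_def)
      also have "exp (n / 2 + c * z) / exp (2 * n) = exp (c * z - 3 * n / 2)"
        by (simp add: exp_diff[symmetric])
      finally show ?case .
    qed
    also have "\<dots> = card ?I * exp (c * z - 3 * n / 2)" by simp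
    also have "\<dots> \<le> 2 ^ n * exp (c * z - 3 * n / 2)"
    proof (rule mult_right_mono)
      have "card ?I \<le> card (Pow {..<n})" by (rule card_mono) auto
      then show "real (card ?I) \<le> 2 ^ n" by (simp add: card_Pow)
    qed simp
    also have "\<dots> \<le> exp 1 ^ n * exp (c * z - 3 * n / 2)"
      using exp_ge_add_one_self[of 1] by (intro mult_right_mono power_mono) auto
    also have "\<dots> = exp (c * z - n / 2)"
      by (simp add: exp_of_nat_mult[symmetric] exp_add[symmetric])
    finally show ?thesis .
  qed
  have "\<forall>\<^sub>F n in sequentially. real n \<ge> c"
    using filterlim_real_sequentially by (auto simp: filterlim_at_top)
  then have "\<forall>\<^sub>F n in sequentially. measure_pmf.prob (gnp n (c / n)) (?X n) \<le> exp (c * z - real n / 2)"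
    by (rule eventually_mono) (rule bound)
  moreover have "(\<lambda>n. exp (c * z - real n / 2)) \<longlonglongrightarrow> 0"
    by real_asymp
  ultimately have "(\<lambda>n. measure_pmf.prob (gnp n (c / n)) (?X n)) \<longlonglongrightarrow> 0"
    by (rule tendsto_zero_prob)
  then show ?thesis using \<mu> by blast
qed

section \<open>Forests with prescribed roots\<close>

text \<open>\<open>A\<close> is taken maximal among the sets that carry such a parent function. An
  edge from \<open>x\<close> in \<open>A\<close> to \<open>y\<close> outside would allow adding
  \<open>y\<close> with parent \<open>x\<close>: the new edge contains \<open>y\<close>, hence
  differs from the old ones, which lie inside \<open>A\<close>.\<close>

lemma exists_closed_forest:
  assumes V: "finite V" and E: "E \<subseteq> all_pairs V" and R: "R \<subseteq> V"
  obtains A f where "R \<subseteq> A" "A \<subseteq> V" "f \<in> (A - R) \<rightarrow>\<^sub>E A" "inj_on (\<lambda>v. {v, f v}) (A - R)"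
    "(\<lambda>v. {v, f v}) ` (A - R) \<subseteq> E" "\<forall>x\<in>A. \<forall>y\<in>V - A. {x, y} \<notin> E"
proof -
  define P where "P A \<longleftrightarrow> R \<subseteq> A \<and> A \<subseteq> V \<and> (\<exists>f \<in> (A - R) \<rightarrow>\<^sub>E A. inj_on (\<lambda>v. {v, f v}) (A - R)
     \<and> (\<lambda>v. {v, f v}) ` (A - R) \<subseteq> E)" for A
  have "P R" unfolding P_def using R by auto
  moreover have "finite {A. P A}"
    by (rule finite_subset[of _ "Pow V"]) (use V in \<open>auto simp: P_def\<close>)
  ultimately obtain A where A: "P A" and max: "\<And>B. P B \<Longrightarrow> A \<subseteq> B \<Longrightarrow> A = B"
    using finite_has_maximal2[of "{A. P A}" R] by auto
  obtain f where f: "f \<in> (A - R) \<rightarrow>\<^sub>E A" "inj_on (\<lambda>v. {v, f v}) (A - R)"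
    "(\<lambda>v. {v, f v}) ` (A - R) \<subseteq> E" and RA: "R \<subseteq> A" and AV: "A \<subseteq> V"
    using A unfolding P_def by auto
  have "{x, y} \<notin> E" if x: "x \<in> A" and y: "y \<in> V - A" for x y
  proof
    assume xy: "{x, y} \<in> E"
    let ?g = "f(y := x)"
    have ins: "insert y A - R = insert y (A - R)" using y RA by auto
    have fA: "f v \<in> A" if "v \<in> A - R" for v using f(1) that by auto
    have "?g \<in> (insert y A - R) \<rightarrow>\<^sub>E insert y A"
      unfolding ins
    proof (rule PiE_I)
      show "?g v \<in> insert y A" if "v \<in> insert y (A - R)" for v
        using that fA[of v] x by auto
      show "?g v = undefined" if "v \<notin> insert y (A - R)" for v
        using that PiE_arb[OF f(1), of v] by simp
    qed
    moreover have "inj_on (\<lambda>v. {v, ?g v}) (insert y A - R)"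
      unfolding ins
    proof (subst inj_on_insert, intro conjI)
      show "inj_on (\<lambda>v. {v, ?g v}) (A - R)"
        using f(2) y by (subst inj_on_cong[where g = "\<lambda>v. {v, f v}"]) auto
      have "y \<notin> {v, ?g v}" if "v \<in> A - R" for v using fA[OF that] that y by auto
      then have "{y, ?g y} \<noteq> {v, ?g v}" if "v \<in> A - R" for v using that by blast
      then show "{y, ?g y} \<notin> (\<lambda>v. {v, ?g v}) ` (A - R - {y})" by blast
    qed
    moreover have "(\<lambda>v. {v, ?g v}) ` (insert y A - R) \<subseteq> E"
      unfolding ins using f(3) xy y by (auto simp: insert_commute)
    moreover have "R \<subseteq> insert y A" "insert y A \<subseteq> V" using RA AV y by auto
    ultimately have "P (insert y A)" unfolding P_def by blast
    from max[OF this] y show False by auto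
  qed
  then have "\<forall>x\<in>A. \<forall>y\<in>V - A. {x, y} \<notin> E" by blast
  then show thesis by (rule that[OF RA AV f])
qed

definition cross_pairs :: "'a set \<Rightarrow> 'a set \<Rightarrow> 'a set set" where
  "cross_pairs A B = (\<lambda>(x, y). {x, y}) ` (A \<times> B)"

lemma card_cross_pairs:
  assumes "A \<inter> B = {}" shows "card (cross_pairs A B) = card A * card B"
proof -
  have "inj_on (\<lambda>(x, y). {x, y}) (A \<times> B)"
    using assms by (auto simp: inj_on_def doubleton_eq_iff)
  then show ?thesis by (simp add: cross_pairs_def card_image card_cartesian_product)
qed

text \<open>One term of the binomial expansion of \<open>(x + (1 - x)) ^ m = 1\<close>. The last
  hypothesis admits \<open>x = 1\<close> only when the exponent \<open>m - b\<close> is 0, which is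
  the case of a vertex set filling the whole graph.\<close>

lemma binomial_mult_power_le:
  fixes x :: real
  assumes "0 \<le> x" "x \<le> 1" "b \<le> m" "x < 1 \<or> b = m"
  shows "real (m choose b) * x ^ b \<le> exp (- real (m - b) * ln (1 - x))"
proof -
  have "real (m choose b) * x ^ b * (1 - x) ^ (m - b)
      \<le> (\<Sum>k\<le>m. real (m choose k) * x ^ k * (1 - x) ^ (m - k))"
    by (rule member_le_sum) (use assms in auto)
  also have "\<dots> = 1" using binomial_ring[of x "1 - x" m] by simp
  finally have *: "real (m choose b) * x ^ b * (1 - x) ^ (m - b) \<le> 1" .
  show ?thesis
  proof (cases "x < 1")
    case True
    have "(1 - x) ^ (m - b) = exp (real (m - b) * ln (1 - x))"
      using True by (simp add: exp_of_nat_mult)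
    then show ?thesis using * by (simp add: exp_minus field_simps)
  next
    case False
    then show ?thesis using * assms by simp
  qed
qed

text \<open>Here \<open>f\<close> plays the role of the parent function of a forest on \<open>A\<close> with root set \<open>R\<close>.
  Acyclicity is not required, because the union bound only needs the edges \<open>{v, f v}\<close> to be
  distinct.\<close>

definition forest_event :: "nat \<Rightarrow> nat set \<Rightarrow> real \<Rightarrow> nat set \<Rightarrow> (nat \<Rightarrow> nat) \<Rightarrow> nat ugraph set" where
  "forest_event n R q A f = {G. let F = (\<lambda>v. {v, f v}) ` (A - R) in
     inj_on (\<lambda>v. {v, f v}) (A - R) \<and> F \<subseteq> all_pairs A \<and> F \<subseteq> edges G
     \<and> cross_pairs A ({..<n} - A) \<inter> edges G = {}
     \<and> real (card ((all_pairs A - F) \<inter> edges G)) \<le> q}"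

text \<open>The pattern bound with the forest edges present, the pairs leaving \<open>A\<close>
  absent and few edges among the other pairs inside \<open>A\<close>. There are at least
  \<open>t * (t - 1) / 2 - t = t^2 / 2 - 3 / 2 * t\<close> of the latter.\<close>

lemma prob_forest_event_le:
  fixes c z q :: real
  assumes c: "c > 0" "c \<le> n" and z: "0 < z" "z \<le> 1"
    and A: "A \<subseteq> {..<n}" "R \<subseteq> A" "card A = t" "card R = i"
  shows "measure_pmf.prob (gnp n (c / n)) (forest_event n R q A f)
    \<le> (c / n) ^ (t - i) * exp (- (c / n) * (real t * (real n - real t)))
       * exp (- (c / n) * (1 - z) * (real t ^ 2 / 2 - 3 / 2 * real t)) / z powr q"
proof -
  let ?F = "(\<lambda>v. {v, f v}) ` (A - R)" and ?N = "cross_pairs A ({..<n} - A)"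
  let ?M = "all_pairs A - ?F"
  let ?p = "c / real n"
  have finA: "finite A" using A finite_subset by blast
  then have finR: "finite R" using A finite_subset by blast
  have p: "0 \<le> ?p" "?p \<le> 1" using c by (auto simp: field_simps)
  have tn: "t \<le> n" using card_mono[OF _ A(1)] A by simp
  show ?thesis
  proof (cases "inj_on (\<lambda>v. {v, f v}) (A - R) \<and> ?F \<subseteq> all_pairs A")
    case True
    have AA: "all_pairs A \<subseteq> all_pairs {..<n}" by (rule all_pairs_mono[OF A(1)])
    have cF: "card ?F = t - i" using True A finR by (simp add: card_image card_Diff_subset)
    have cN: "real (card ?N) = real t * (real n - real t)"
      using A tn finA by (simp add: card_cross_pairs card_Diff_subset of_nat_diff)
    have "card (all_pairs A) = t choose 2" using finA A by (simp add: card_all_pairs)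
    then have "real (card (all_pairs A)) = real t * (real t - 1) / 2"
      by (cases t) (auto simp: choose_two real_of_nat_div field_simps)
    moreover have "real (card ?M) = real (card (all_pairs A)) - real (t - i)"
      using True cF finA by (subst card_Diff_subset) (auto simp: of_nat_diff card_mono cF[symmetric])
    moreover have "real (t - i) \<le> t" by simp
    ultimately have cM: "real (card ?M) \<ge> real t ^ 2 / 2 - 3 / 2 * real t"
      by (simp add: power2_eq_square field_simps)
    have dN: "all_pairs A \<inter> ?N = {}" by (auto simp: all_pairs_def cross_pairs_def)
    have "?N \<subseteq> all_pairs {..<n}" using A by (auto simp: all_pairs_def cross_pairs_def card_2_iff)
    have "measure_pmf.prob (gnp n ?p) (forest_event n R q A f)
       = measure_pmf.prob (gnp n ?p)
           {G. ?F \<subseteq> edges G \<and> ?N \<inter> edges G = {} \<and> real (card (?M \<inter> edges G)) \<le> q}"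
      using True by (simp add: forest_event_def Let_def)
    also have "\<dots> \<le> ?p ^ card ?F * exp (- ?p * card ?N) * exp (- ?p * (1 - z) * card ?M) / z powr q"
      by (rule gnp_prob_pattern_le[OF p z]) (use True AA dN \<open>?N \<subseteq> all_pairs {..<n}\<close> in blast)+
    also have "\<dots> \<le> ?p ^ card ?F * exp (- ?p * card ?N)
        * exp (- ?p * (1 - z) * (real t ^ 2 / 2 - 3 / 2 * real t)) / z powr q"
    proof -
      have "?p * (1 - z) * (real t ^ 2 / 2 - 3 / 2 * real t) \<le> ?p * (1 - z) * card ?M"
        using cM p z by (intro mult_left_mono mult_nonneg_nonneg) auto
      then show ?thesis using p by (intro divide_right_mono mult_left_mono) auto
    qed
    finally show ?thesis unfolding cF cN .
  next
    \<comment> \<open>Injectivity and containment in \<open>A\<close> are part of the event, so it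
      is empty here and the bound holds for every \<open>f\<close>.\<close>
    case False
    then have "forest_event n R q A f = {}" by (auto simp: forest_event_def Let_def)
    then show ?thesis using c by simp
  qed
qed

text \<open>Choosing the roots to be \<open>{..<i}\<close> in advance leaves at most
  \<open>(n - i choose t - i) * t ^ (t - i)\<close> pairs \<open>(A, f)\<close>, and the binomial coefficient is absorbed
  exactly by \<open>(1 - x) ^ (n - t)\<close>.\<close>

lemma prob_exists_forest_event_le:
  fixes c z q :: real
  assumes c: "c \<ge> 1" "c \<le> n" and z: "0 < z" "z \<le> 1"
    and it: "i \<le> t" "t \<le> n" and x: "x = real t / n"
  shows "measure_pmf.prob (gnp n (c / n))
      (\<Union>A\<in>{A. {..<i} \<subseteq> A \<and> A \<subseteq> {..<n} \<and> card A = t}. \<Union>f\<in>(A - {..<i}) \<rightarrow>\<^sub>E A. forest_event n {..<i} q A f)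
    \<le> exp (n * (- (1 - x) * ln (1 - x) + x * ln c - c * x * (1 - x) - c * (1 - z) * x\<^sup>2 / 2)
           + 3 / 2 * c - q * ln z)"
proof -
  let ?R = "{..<i}" and ?p = "c / real n"
  let ?As = "{A. ?R \<subseteq> A \<and> A \<subseteq> {..<n} \<and> card A = t}"
  have n0: "real n > 0" using c by linarith
  have x01: "0 \<le> x" "x \<le> 1" using it n0 by (auto simp: x)
  define B where "B = ?p ^ (t - i) * exp (- ?p * (real t * (real n - real t)))
       * exp (- ?p * (1 - z) * (real t ^ 2 / 2 - 3 / 2 * real t)) / z powr q"
  have B0: "B \<ge> 0" unfolding B_def using c by simp
  have finAs: "finite ?As" by (rule finite_subset[of _ "Pow {..<n}"]) auto
  have "measure_pmf.prob (gnp n ?p) (\<Union>A\<in>?As. \<Union>f\<in>(A - ?R) \<rightarrow>\<^sub>E A. forest_event n ?R q A f)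
    \<le> (\<Sum>A\<in>?As. real t ^ (t - i) * B)"
  proof (rule gnp_union_bound[where Y = "\<lambda>A. \<Union>f\<in>(A - ?R) \<rightarrow>\<^sub>E A. forest_event n ?R q A f"], goal_cases)
    case (3 A)
    then have A: "A \<subseteq> {..<n}" "?R \<subseteq> A" "card A = t" by auto
    have finA: "finite A" using A finite_subset by blast
    have "measure_pmf.prob (gnp n ?p) (\<Union>f\<in>(A - ?R) \<rightarrow>\<^sub>E A. forest_event n ?R q A f)
       \<le> (\<Sum>f\<in>(A - ?R) \<rightarrow>\<^sub>E A. B)"
    proof (rule gnp_union_bound[where Y = "forest_event n ?R q A"], goal_cases)
      case 1 show ?case using finA by (intro finite_PiE) auto
    next
      case (3 f)
      show ?case unfolding B_def by (rule prob_forest_event_le) (use c z A in auto)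
    qed auto
    also have "\<dots> = real t ^ (t - i) * B"
      using A finA by (simp add: card_PiE card_Diff_subset)
    finally show ?case .
  qed (use finAs in auto)
  also have "\<dots> = real (card ?As) * (real t ^ (t - i) * B)" by simp
  also have "\<dots> \<le> real ((n - i) choose (t - i)) * (real t ^ (t - i) * B)"
  proof (rule mult_right_mono)
    let ?Bs = "{S. S \<subseteq> {..<n} - ?R \<and> card S = t - i}"
    have "card ?As \<le> card ?Bs"
    proof (rule card_inj_on_le[where f = "\<lambda>A. A - ?R"])
      show "inj_on (\<lambda>A. A - ?R) ?As" by (auto simp: inj_on_def)
      show "(\<lambda>A. A - ?R) ` ?As \<subseteq> ?Bs" by (auto simp: card_Diff_subset)
      show "finite ?Bs" by (rule finite_subset[of _ "Pow {..<n}"]) auto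
    qed
    also have "\<dots> = card ({..<n} - ?R) choose (t - i)" by (rule n_subsets) simp
    also have "card ({..<n} - ?R) = n - i" using it by (subst card_Diff_subset) auto
    finally show "real (card ?As) \<le> real ((n - i) choose (t - i))" by simp
  qed (use B0 in simp)
  \<comment> \<open>The \<open>t ^ (t - i)\<close> choices of parents and the factor
    \<open>n ^ (t - i)\<close> in the denominator of the edge probabilities combine to
    \<open>x ^ (t - i)\<close>, as needed to absorb the binomial coefficient.\<close>
  also have "\<dots> = (real ((n - i) choose (t - i)) * x ^ (t - i)) * (c ^ (t - i)
      * (exp (- ?p * (real t * (real n - real t)))
       * exp (- ?p * (1 - z) * (real t ^ 2 / 2 - 3 / 2 * real t)) / z powr q))"
  proof -
    have "real t ^ (t - i) * ?p ^ (t - i) = x ^ (t - i) * c ^ (t - i)"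
      by (simp add: x power_mult_distrib[symmetric])
    then show ?thesis unfolding B_def by (simp add: mult_ac)
  qed
  \<comment> \<open>Here \<open>c \<ge> 1\<close> allows replacing \<open>c ^ (t - i)\<close> by
    \<open>c ^ t\<close>. Together with \<open>(n - i) - (t - i) = n - t\<close> this removes the
    number of roots from the bound.\<close>
  also have "\<dots> \<le> exp (- real (n - t) * ln (1 - x)) * (exp (t * ln c)
      * (exp (- ?p * (real t * (real n - real t)))
       * exp (- ?p * (1 - z) * (real t ^ 2 / 2 - 3 / 2 * real t)) / z powr q))"
  proof (intro mult_mono)
    have "n - i - (t - i) = n - t" using it by simp
    moreover have "x < 1 \<or> t - i = n - i" using it n0 by (cases "t = n") (auto simp: x)
    ultimately show "real ((n - i) choose (t - i)) * x ^ (t - i) \<le> exp (- real (n - t) * ln (1 - x))"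
      using binomial_mult_power_le[of x "t - i" "n - i"] x01 it by simp
    have "c ^ (t - i) \<le> c ^ t" using c by (intro power_increasing) auto
    also have "\<dots> = exp (t * ln c)" using c by (simp add: exp_of_nat_mult)
    finally show "c ^ (t - i) \<le> exp (t * ln c)" .
  qed (use c x01 in auto)
  also have "\<dots> = exp (- real (n - t) * ln (1 - x) + t * ln c - ?p * (real t * (real n - real t))
      - ?p * (1 - z) * (real t ^ 2 / 2 - 3 / 2 * real t) - q * ln z)"
  proof -
    have "z powr q = exp (q * ln z)" using z by (simp add: powr_def)
    then show ?thesis
      by (simp only: exp_add[symmetric] exp_diff[symmetric] times_divide_eq_right) simp
  qed
  \<comment> \<open>Substituting \<open>t = n * x\<close> makes every term proportional to
    \<open>n\<close>, except the correction from \<open>3 / 2 * t\<close>, which is at most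
    \<open>3 / 2 * c\<close>, and the term with \<open>q\<close>.\<close>
  also have "\<dots> \<le> exp (n * (- (1 - x) * ln (1 - x) + x * ln c - c * x * (1 - x) - c * (1 - z) * x\<^sup>2 / 2)
           + 3 / 2 * c - q * ln z)"
  proof -
    have t: "real t = n * x" "real (n - t) = n * (1 - x)"
      using n0 it by (auto simp: x of_nat_diff algebra_simps)
    have 1: "?p * (1 - z) * (real t ^ 2 / 2 - 3 / 2 * real t)
       = n * (c * (1 - z) * x\<^sup>2 / 2) - 3 / 2 * c * ((1 - z) * x)"
      using n0 by (simp add: t power_mult_distrib power2_eq_square) (simp add: field_simps)?
    have "(1 - z) * x \<le> 1 * 1" using z x01 by (intro mult_mono) auto
    then have 2: "3 / 2 * c * ((1 - z) * x) \<le> 3 / 2 * c * 1" using c by (intro mult_left_mono) auto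
    have 3: "?p * (real t * (real n - real t)) = n * (c * x * (1 - x))"
      using n0 by (simp add: t field_simps)
    have 4: "- real (n - t) * ln (1 - x) = n * (- (1 - x) * ln (1 - x))" "t * ln c = n * (x * ln c)"
      by (simp_all only: t mult_minus_left mult_minus_right mult.assoc)
    show ?thesis
      unfolding exp_le_cancel_iff 1 3 4 distrib_left[of "real n"] right_diff_distrib[of "real n"]
      using 2 by linarith
  qed
  finally show ?thesis .
qed

section \<open>A dense set in the supercritical random graph\<close>

text \<open>At 0 the slope of \<open>h\<close> is \<open>1 + ln c - c\<close>, which is negative for
  \<open>c > 1\<close>; this settles small \<open>x\<close> without counting extra edges. From
  \<open>\<beta>\<close> on, the exponent with the additional \<open>c * x^2 / 2\<close> does not
  increase, so it inherits a negative bound from \<open>\<beta>\<close>. By compactness of the gap,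
  a small positive \<open>z\<close> keeps the sign.\<close>

lemma forest_exponent_negative:
  fixes c :: real
  assumes c: "c > 1"
  defines "h \<equiv> \<lambda>x. - (1 - x) * ln (1 - x) + x * ln c - c * x * (1 - x)"
  shows "\<exists>\<theta>>0. \<exists>z \<beta>. 0 < z \<and> z < 1 \<and> (\<forall>x. 0 \<le> x \<and> x \<le> \<beta> \<longrightarrow> h x \<le> - \<theta> * x)
    \<and> (\<forall>x. \<beta> \<le> x \<and> x \<le> 1 \<longrightarrow> h x - c * (1 - z) * x\<^sup>2 / 2 \<le> - \<theta>)"
proof -
  define a where "a = c - 1 - ln c"
  have a: "a > 0" using ln_le_minus_one[of c] ln_eq_minus_one[of c] c by (force simp: a_def)
  have ac: "a < c" using ln_gt_zero[OF c] unfolding a_def by linarith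
  \<comment> \<open>Since \<open>h x \<le> x * (c * x - a)\<close>, up to this point at least half
    of the negative slope \<open>- a\<close> remains.\<close>
  define \<beta> where "\<beta> = a / (2 * c)"
  have \<beta>: "0 < \<beta>" "\<beta> < 1" using a ac c by (auto simp: \<beta>_def field_simps)
  have small: "h x \<le> - (a / 2) * x" if x: "0 \<le> x" "x \<le> \<beta>" for x
  proof -
    have x1: "1 - x > 0" using x \<beta> by simp
    have "- ln (1 - x) \<le> 1 / (1 - x) - 1"
      using ln_le_minus_one[of "1 / (1 - x)"] x1 by (simp add: ln_div)
    then have "(1 - x) * (- ln (1 - x)) \<le> (1 - x) * (1 / (1 - x) - 1)"
      using x1 by (intro mult_left_mono) auto
    also have "\<dots> = x" using x1 by (simp add: field_simps)
    finally have "h x \<le> x * (c * x - a)" by (simp add: h_def a_def algebra_simps)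
    also have "\<dots> \<le> x * (- (a / 2))"
      using x c by (intro mult_left_mono) (auto simp: \<beta>_def field_simps)
    finally show ?thesis by (simp add: mult.commute)
  qed
  define F where "F x = h x - c * x\<^sup>2 / 2" for x
  have F_le: "F x \<le> F \<beta>" if x: "\<beta> \<le> x" "x < 1" for x
  proof (rule DERIV_nonpos_imp_nonincreasing[OF x(1)])
    fix y assume y: "\<beta> \<le> y" "y \<le> x"
    then have y1: "1 - y > 0" using x by simp
    have "(F has_real_derivative ln (1 - y) + 1 + ln c - c + c * y) (at y)"
      unfolding F_def h_def using y1
      by (auto intro!: derivative_eq_intros simp: algebra_simps) (simp add: field_simps)
    moreover have "ln (1 - y) + 1 + ln c - c + c * y \<le> 0"
    proof -
      have "ln (c * (1 - y)) = ln c + ln (1 - y)" using y1 c by (intro ln_mult_pos) auto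
      moreover have "ln (c * (1 - y)) \<le> c * (1 - y) - 1"
        using y1 c by (intro ln_le_minus_one) auto
      ultimately show ?thesis by (simp add: right_diff_distrib)
    qed
    ultimately show "\<exists>D. (F has_real_derivative D) (at y) \<and> D \<le> 0" by blast
  qed
  \<comment> \<open>The first entry bounds \<open>F\<close> on \<open>\<beta> \<le> x < 1\<close>.
    The second is \<open>- F 1\<close>, treated separately because the derivative involves
    \<open>ln (1 - x)\<close>; at 1 the entropy term is 0.\<close>
  define \<theta>0 where "\<theta>0 = min (a / 2 * \<beta>) (c / 2 - ln c)"
  have "ln c < c / 2"
    using ln_le_minus_one[of "c / 2"] ln_2_less_1 c by (simp add: ln_div)
  then have \<theta>0: "\<theta>0 > 0" using a \<beta> by (simp add: \<theta>0_def)
  have large: "F x \<le> - \<theta>0" if x: "\<beta> \<le> x" "x \<le> 1" for x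
  proof (cases "x = 1")
    case True
    then show ?thesis by (simp add: F_def h_def \<theta>0_def)
  next
    case False
    have "F \<beta> \<le> h \<beta>" using c by (simp add: F_def)
    moreover have "h \<beta> \<le> - (a / 2) * \<beta>" using small \<beta> by simp
    moreover have "F x \<le> F \<beta>" using F_le x False by simp
    ultimately show ?thesis by (simp add: \<theta>0_def)
  qed
  \<comment> \<open>Replacing \<open>c * x^2 / 2\<close> by \<open>c * (1 - z) * x^2 / 2\<close>
    raises the exponent by at most \<open>c * z / 2 \<le> \<theta>0 / 2\<close>.\<close>
  define z where "z = min (1 / 2) (\<theta>0 / c)"
  have z: "0 < z" "z < 1" using \<theta>0 c by (auto simp: z_def)
  define \<theta> where "\<theta> = min (\<theta>0 / 2) (a / 2)"
  have "h x - c * (1 - z) * x\<^sup>2 / 2 \<le> - \<theta>" if x: "\<beta> \<le> x" "x \<le> 1" for x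
  proof -
    have "x\<^sup>2 \<le> 1" using x \<beta> by (simp add: power_le_one)
    moreover have "c * z \<le> \<theta>0" using c by (simp add: z_def min_def field_simps)
    ultimately have "c * z * x\<^sup>2 \<le> \<theta>0 * 1" using \<theta>0 by (intro mult_mono) auto
    then show ?thesis using large[OF x] by (simp add: F_def \<theta>_def algebra_simps)
  qed
  moreover have "h x \<le> - \<theta> * x" if x: "0 \<le> x" "x \<le> \<beta>" for x
  proof -
    have "\<theta> * x \<le> a / 2 * x" using x by (intro mult_right_mono) (auto simp: \<theta>_def)
    then show ?thesis using small[OF x] by linarith
  qed
  moreover have "\<theta> > 0" using \<theta>0 a by (simp add: \<theta>_def)
  ultimately show ?thesis using z by blast
qed

text \<open>If no such set exists, the closed set \<open>A\<close> grown from the roots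
  \<open>{..<i}\<close> carries \<open>card A - i\<close> forest edges and hence at most
  \<open>i + \<eta> * n\<close> others. So some forest event with \<open>q = i + \<eta> * n\<close>
  occurs, and for each size \<open>t\<close> of \<open>A\<close> this is exponentially
  unlikely.\<close>

lemma gnp_dense_subset:
  fixes c :: real
  assumes c: "c > 1"
  shows "\<exists>\<delta>>0. (\<lambda>n. measure_pmf.prob (gnp n (c / n))
     {G. \<not> (\<exists>A\<subseteq>verts G. real (card (edges_within (edges G) A)) \<ge> card A + \<delta> * real n)}) \<longlonglongrightarrow> 0"
proof -
  obtain \<theta> z \<beta> where \<theta>: "\<theta> > 0" and z: "0 < z" "z < 1"
    and small: "\<And>x. 0 \<le> x \<Longrightarrow> x \<le> \<beta> \<Longrightarrow>
       - (1 - x) * ln (1 - x) + x * ln c - c * x * (1 - x) \<le> - \<theta> * x"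
    and large: "\<And>x. \<beta> \<le> x \<Longrightarrow> x \<le> 1 \<Longrightarrow>
       - (1 - x) * ln (1 - x) + x * ln c - c * x * (1 - x) - c * (1 - z) * x\<^sup>2 / 2 \<le> - \<theta>"
    using forest_exponent_negative[OF c] by blast
  define L where "L = - ln z"
  have L: "L > 0" using z by (simp add: L_def)
  \<comment> \<open>Allowing \<open>q \<le> 2 * \<eta> * n + 1\<close> extra edges costs a factor
    \<open>exp (q * L)\<close>; this choice of \<open>\<eta>\<close> makes it at most
    \<open>exp (\<theta> / 2 * n + L)\<close>, half of the available rate.\<close>
  define \<eta> where "\<eta> = min 1 (\<theta> / (4 * L))"
  have \<eta>: "0 < \<eta>" "\<eta> \<le> 1" using \<theta> L by (auto simp: \<eta>_def)
  have \<eta>L: "2 * \<eta> * L \<le> \<theta> / 2" using L by (simp add: \<eta>_def min_def field_simps)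
  define \<theta>' where "\<theta>' = min (\<theta> / 2) (\<theta> * \<eta>)"
  have \<theta>': "\<theta>' > 0" using \<theta> \<eta> by (simp add: \<theta>'_def)
  let ?X = "\<lambda>n. {G :: nat ugraph. \<not> (\<exists>A\<subseteq>verts G. real (card (edges_within (edges G) A)) \<ge> card A + \<eta> * real n)}"
  have bound: "measure_pmf.prob (gnp n (c / n)) (?X n)
      \<le> (real n + 1) * exp (3 / 2 * c + L - \<theta>' * n)" if n: "real n \<ge> c" for n
  proof -
    define i where "i = nat \<lceil>\<eta> * n\<rceil>"
    have n0: "real n > 0" using n c by linarith
    have i: "real i \<ge> \<eta> * n" "real i \<le> \<eta> * n + 1"
      unfolding i_def using \<eta> by (simp_all add: of_nat_nat)
    have "\<eta> * n \<le> n" using \<eta> by (simp add: mult_left_le_one_le)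
    then have "i \<le> n" unfolding i_def by (simp add: ceiling_le_iff nat_le_iff)
    let ?q = "real i + \<eta> * n" and ?R = "{..<i}"
    let ?Y = "\<lambda>t. \<Union>A\<in>{A. ?R \<subseteq> A \<and> A \<subseteq> {..<n} \<and> card A = t}.
                  \<Union>f\<in>(A - ?R) \<rightarrow>\<^sub>E A. forest_event n ?R ?q A f"
    have "measure_pmf.prob (gnp n (c / n)) (?X n) \<le> (\<Sum>t\<in>{i..n}. exp (3 / 2 * c + L - \<theta>' * n))"
    proof (rule gnp_union_bound[where Y = ?Y], goal_cases)
      case (2 E)
      have Rn: "?R \<subseteq> {..<n}" using \<open>i \<le> n\<close> by auto
      obtain A f where A: "?R \<subseteq> A" "A \<subseteq> {..<n}" and f: "f \<in> (A - ?R) \<rightarrow>\<^sub>E A"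
        "inj_on (\<lambda>v. {v, f v}) (A - ?R)" "(\<lambda>v. {v, f v}) ` (A - ?R) \<subseteq> E"
        and closed: "\<forall>x\<in>A. \<forall>y\<in>{..<n} - A. {x, y} \<notin> E"
        by (rule exists_closed_forest[OF finite_lessThan 2(1) Rn])
      let ?F = "(\<lambda>v. {v, f v}) ` (A - ?R)"
      have finA: "finite A" using A finite_subset by blast
      have fA: "f v \<in> A" if "v \<in> A - ?R" for v using f(1) that by auto
      have FA: "?F \<subseteq> all_pairs A"
      proof (rule image_subsetI)
        fix v assume v: "v \<in> A - ?R"
        then have "{v, f v} \<in> E" using f(3) by blast
        then have "card {v, f v} = 2" using 2(1) unfolding all_pairs_def by blast
        then show "{v, f v} \<in> all_pairs A" using v fA[OF v] by (simp add: all_pairs_def)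
      qed
      have "?F \<union> ((all_pairs A - ?F) \<inter> E) = edges_within E A"
        using FA f(3) edges_within_eq[OF 2(1)] by auto
      then have "card (edges_within E A) = card (?F \<union> ((all_pairs A - ?F) \<inter> E))" by simp
      also have "\<dots> = card ?F + card ((all_pairs A - ?F) \<inter> E)"
        using finA by (intro card_Un_disjoint) auto
      also have "card ?F = card A - i" using f(2) A by (simp add: card_image card_Diff_subset)
      finally have eA: "card (edges_within E A) = card A - i + card ((all_pairs A - ?F) \<inter> E)" .
      have iA: "i \<le> card A" using card_mono[OF finA A(1)] by simp
      have "\<not> (\<exists>A\<subseteq>{..<n}. real (card (edges_within E A)) \<ge> card A + \<eta> * real n)"
        using 2(2) by simp
      then have "real (card (edges_within E A)) < card A + \<eta> * n" using A(2) not_le by blast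
      then have "real (card ((all_pairs A - ?F) \<inter> E)) \<le> ?q"
        unfolding eA using iA by (simp add: of_nat_diff)
      moreover have "cross_pairs A ({..<n} - A) \<inter> E = {}"
        using closed by (auto simp: cross_pairs_def)
      ultimately have "({..<n}, E) \<in> forest_event n ?R ?q A f"
        unfolding forest_event_def Let_def using f FA by simp
      then have "({..<n}, E) \<in> (\<Union>f\<in>(A - ?R) \<rightarrow>\<^sub>E A. forest_event n ?R ?q A f)"
        by (rule UN_I[OF f(1)])
      then have "({..<n}, E) \<in> ?Y (card A)" by (rule UN_I[rotated]) (use A in simp)
      moreover have "card A \<in> {i..n}" using iA card_mono[OF _ A(2)] by simp
      ultimately show ?case by (rule bexI)
    next
      case (3 t)
      then have t: "i \<le> t" "t \<le> n" by auto
      define x where "x = real t / n"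
      have x: "\<eta> \<le> x" "x \<le> 1" using t i n0 by (auto simp: x_def field_simps)
      let ?h = "- (1 - x) * ln (1 - x) + x * ln c - c * x * (1 - x)"
      show ?case
      proof (cases "x \<le> \<beta>")
        case True
        \<comment> \<open>Small sets: the tilt 1 ignores the extra edges. As \<open>A\<close>
          contains the roots, \<open>x \<ge> \<eta>\<close>, and the linear bound on the exponent
          becomes the fixed rate \<open>\<theta> * \<eta>\<close>.\<close>
        have "measure_pmf.prob (gnp n (c / n)) (?Y t)
          \<le> exp (n * (?h - c * (1 - 1) * x\<^sup>2 / 2) + 3 / 2 * c - ?q * ln 1)"
          by (rule prob_exists_forest_event_le) (use c n t x_def in auto)
        also have "\<dots> \<le> exp (3 / 2 * c + L - \<theta>' * n)"
        proof -
          have "?h \<le> - \<theta> * x" using small True x \<eta> by auto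
          also have "\<dots> \<le> - \<theta> * \<eta>" using x \<theta> by simp
          also have "\<dots> \<le> - \<theta>'" by (simp add: \<theta>'_def)
          finally have "n * ?h \<le> n * (- \<theta>')" by (intro mult_left_mono) auto
          then show ?thesis using L by (simp add: mult.commute)
        qed
        finally show ?thesis .
      next
        case False
        \<comment> \<open>Large sets: the scarcity of extra edges enters through the tilt
          \<open>z\<close>, and the rate \<open>\<theta>\<close> pays for the factor from
          \<open>q\<close>.\<close>
        have "measure_pmf.prob (gnp n (c / n)) (?Y t)
          \<le> exp (n * (?h - c * (1 - z) * x\<^sup>2 / 2) + 3 / 2 * c - ?q * ln z)"
          by (rule prob_exists_forest_event_le) (use c n t x_def z in auto)
        also have "\<dots> \<le> exp (3 / 2 * c + L - \<theta>' * n)"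
        proof -
          have "n * (?h - c * (1 - z) * x\<^sup>2 / 2) \<le> n * (- \<theta>)"
            using large[of x] False x by (intro mult_left_mono) auto
          moreover have "?q * L \<le> (2 * \<eta> * n + 1) * L" using i L by (intro mult_right_mono) auto
          moreover have "2 * \<eta> * L * n \<le> \<theta> / 2 * n" using \<eta>L by (intro mult_right_mono) auto
          moreover have "\<theta>' * n \<le> \<theta> / 2 * n" by (intro mult_right_mono) (auto simp: \<theta>'_def)
          moreover have "(2 * \<eta> * n + 1) * L = 2 * \<eta> * L * n + L" by (simp add: algebra_simps)
          moreover have "?q * ln z = - (?q * L)" by (simp add: L_def)
          moreover have "n * (- \<theta>) = - (2 * (\<theta> / 2 * n))" by simp
          ultimately show ?thesis unfolding exp_le_cancel_iff by linarith
        qed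
        finally show ?thesis .
      qed
    qed simp
    also have "\<dots> = real (card {i..n}) * exp (3 / 2 * c + L - \<theta>' * n)" by simp
    also have "\<dots> \<le> (real n + 1) * exp (3 / 2 * c + L - \<theta>' * n)"
      by (intro mult_right_mono) auto
    finally show ?thesis .
  qed
  have "\<forall>\<^sub>F n in sequentially. real n \<ge> c"
    using filterlim_real_sequentially by (auto simp: filterlim_at_top)
  then have "\<forall>\<^sub>F n in sequentially. measure_pmf.prob (gnp n (c / n)) (?X n)
      \<le> (real n + 1) * exp (3 / 2 * c + L - \<theta>' * n)"
    by (rule eventually_mono) (rule bound)
  moreover have "(\<lambda>n. (real n + 1) * exp (3 / 2 * c + L - \<theta>' * real n)) \<longlonglongrightarrow> 0"
    using \<theta>' by real_asymp
  ultimately have "(\<lambda>n. measure_pmf.prob (gnp n (c / n)) (?X n)) \<longlonglongrightarrow> 0"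
    by (rule tendsto_zero_prob)
  then show ?thesis using \<eta>(1) by blast
qed

section \<open>Expanders in the supercritical random graph\<close>

text \<open>Double counting: a neighbor \<open>w\<close> of \<open>v\<close> in \<open>S\<close>
  corresponds to the edge \<open>{v, w}\<close> with its end \<open>v\<close> marked, and an edge
  has two ends.\<close>

lemma degree_sum_le_twice_incident_edges:
  assumes V: "finite V" and E: "E \<subseteq> all_pairs V" and S: "S \<subseteq> V"
    and deg: "\<And>v. v \<in> S \<Longrightarrow> D \<le> card {w \<in> V. {v, w} \<in> E}"
  shows "D * card S \<le> 2 * card {e \<in> E. e \<inter> S \<noteq> {}}"
proof -
  let ?T = "{e \<in> E. e \<inter> S \<noteq> {}}"
  have finS: "finite S" using S V finite_subset by blast
  have "finite E" using E V finite_all_pairs finite_subset by blast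
  then have finT: "finite ?T" by simp
  have c2: "card e = 2" if "e \<in> ?T" for e using that E by (auto simp: all_pairs_def)
  have fe: "finite e" if "e \<in> ?T" for e using c2[OF that] by (simp add: card_ge_0_finite)
  have "D * card S = (\<Sum>v\<in>S. D)" by simp
  also have "\<dots> \<le> (\<Sum>v\<in>S. card {w \<in> V. {v, w} \<in> E})" by (intro sum_mono deg)
  also have "\<dots> = card (SIGMA v:S. {w \<in> V. {v, w} \<in> E})" using finS V by simp
  also have "\<dots> \<le> card (SIGMA e:?T. e)"
  proof (rule card_inj_on_le[where f = "\<lambda>(v, w). ({v, w}, v)"])
    show "inj_on (\<lambda>(v, w). ({v, w}, v)) (SIGMA v:S. {w \<in> V. {v, w} \<in> E})"
      by (auto simp: inj_on_def doubleton_eq_iff)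
    show "finite (SIGMA e:?T. e)" using finT fe by (intro finite_SigmaI) auto
  qed auto
  also have "\<dots> = (\<Sum>e\<in>?T. card e)" using finT fe by (intro card_SigmaI) auto
  also have "\<dots> = (\<Sum>e\<in>?T. 2)" by (intro sum.cong) (use c2 in auto)
  finally show ?thesis by simp
qed

text \<open>Deletes the set \<open>S\<close> of vertices of degree above \<open>D\<close>. This
  costs fewer than \<open>\<delta> / 2 * card V\<close> edges, so the excess left in
  \<open>A - S\<close> is at least \<open>2 * \<nu> * card (A - S)\<close>, and the deterministic
  expander lemma applies with degrees bounded on \<open>V - S\<close>.\<close>

lemma expander_in_typical_graph:
  fixes \<delta> \<mu> \<nu> \<alpha> :: real
  assumes V: "finite V" "V \<noteq> {}" and E: "E \<subseteq> all_pairs V"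
    and pos: "\<delta> > 0" "\<mu> > 0" "\<nu> > 0" "\<alpha> > 0" and \<nu>: "\<nu> \<le> \<delta> / 4"
    and D: "D > 0" "\<delta> \<le> \<mu> * D"
    and A: "A \<subseteq> V" "real (card (edges_within E A)) \<ge> card A + \<delta> * real (card V)"
    and few: "\<And>S. S \<subseteq> V \<Longrightarrow> real (card S) \<le> \<mu> * real (card V) + 1 \<Longrightarrow>
       real (card {e \<in> E. e \<inter> S \<noteq> {}}) < \<delta> / 2 * real (card V)"
    and sparse: "\<And>W. W \<subseteq> V \<Longrightarrow> W \<noteq> {} \<Longrightarrow> real (card W) \<le> \<alpha> * card V \<Longrightarrow>
       real (card (edges_within E W)) < (1 + \<nu>) * card W"
  shows "\<exists>H. induced_subgraph H (V, E) \<and> max_degree_le H D \<and> expander (\<nu> * \<alpha> / D) H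
           \<and> real (card (verts H)) \<ge> \<alpha> * card V"
proof -
  let ?n = "real (card V)"
  let ?d = "\<lambda>v. card {w \<in> V. {v, w} \<in> E}"
  define S where "S = {v \<in> V. ?d v > D}"
  have SV: "S \<subseteq> V" by (auto simp: S_def)
  have n: "?n > 0" using V by (simp add: card_gt_0_iff)
  have finE: "finite E" using E V finite_all_pairs finite_subset by blast
  have finA: "finite A" using A V finite_subset by blast
  have "real (card S) \<le> \<mu> * ?n + 1"
  proof (rule ccontr)
    assume neg: "\<not> real (card S) \<le> \<mu> * ?n + 1"
    \<comment> \<open>If \<open>S\<close> were too large, a subset of exactly this size would still
      be covered by \<open>few\<close>, yet its degree sum would force at least
      \<open>D * \<mu> * ?n / 2 \<ge> \<delta> / 2 * ?n\<close> incident edges.\<close>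
    define s where "s = nat \<lfloor>\<mu> * ?n\<rfloor> + 1"
    have "real s = real_of_int \<lfloor>\<mu> * ?n\<rfloor> + 1"
      unfolding s_def using pos n by (simp add: of_nat_nat)
    then have s: "real s \<le> \<mu> * ?n + 1" "real s \<ge> \<mu> * ?n" by linarith+
    then have "s \<le> card S" using neg by linarith
    then obtain S' where S': "S' \<subseteq> S" "card S' = s" by (meson obtain_subset_with_card_n)
    have "D * card S' \<le> 2 * card {e \<in> E. e \<inter> S' \<noteq> {}}"
      by (rule degree_sum_le_twice_incident_edges[OF V(1) E]) (use S' in \<open>auto simp: S_def\<close>)
    then have "real D * s \<le> 2 * real (card {e \<in> E. e \<inter> S' \<noteq> {}})"
      unfolding S'(2) by (metis of_nat_le_iff of_nat_mult of_nat_numeral)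
    moreover have "real (card {e \<in> E. e \<inter> S' \<noteq> {}}) < \<delta> / 2 * ?n"
      by (rule few) (use S' SV s in auto)
    moreover have "real D * s \<ge> real D * (\<mu> * ?n)" using s by (intro mult_left_mono) auto
    moreover have "real D * (\<mu> * ?n) \<ge> \<delta> * ?n"
      using mult_right_mono[OF D(2), of ?n] n by (simp add: mult_ac)
    ultimately show False by linarith
  qed
  then have fewS: "real (card {e \<in> E. e \<inter> S \<noteq> {}}) < \<delta> / 2 * ?n" using few SV by blast
  define U0 where "U0 = A - S"
  have "edges_within E A \<subseteq> edges_within E U0 \<union> {e \<in> E. e \<inter> S \<noteq> {}}"
    by (auto simp: edges_within_def U0_def)
  then have "card (edges_within E A) \<le> card (edges_within E U0 \<union> {e \<in> E. e \<inter> S \<noteq> {}})"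
    by (intro card_mono) (use finE in \<open>auto simp: edges_within_def\<close>)
  also have "\<dots> \<le> card (edges_within E U0) + card {e \<in> E. e \<inter> S \<noteq> {}}" by (rule card_Un_le)
  finally have "real (card (edges_within E U0)) \<ge> card A + \<delta> / 2 * ?n" using A(2) fewS by linarith
  moreover have "card U0 \<le> card A" unfolding U0_def using finA by (intro card_mono) auto
  ultimately have eU0: "real (card (edges_within E U0)) \<ge> card U0 + \<delta> / 2 * ?n" by linarith
  have "card U0 \<le> card V" using A V by (intro card_mono) (auto simp: U0_def)
  then have "2 * \<nu> * card U0 \<le> \<delta> / 2 * ?n" using \<nu> pos by (intro mult_mono) auto
  with eU0 have dense: "real (card (edges_within E U0)) \<ge> (1 + 2 * \<nu>) * card U0"
    by (simp add: algebra_simps)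
  have "U0 \<noteq> {}"
  proof
    assume "U0 = {}"
    moreover have "edges_within E {} = {}" using E by (auto simp: edges_within_def all_pairs_def)
    ultimately have "\<delta> / 2 * ?n \<le> 0" using eU0 by simp
    moreover have "\<delta> / 2 * ?n > 0" using pos n by (intro mult_pos_pos) auto
    ultimately show False by linarith
  qed
  show ?thesis
    by (rule expander_of_locally_sparse[OF V E, where X = "V - S" and ?U0.0 = U0])
      (use A D pos dense \<open>U0 \<noteq> {}\<close> sparse in \<open>auto simp: S_def U0_def\<close>)
qed

theorem corollary1:
  fixes \<epsilon> :: real
  assumes "\<epsilon> > 0"
  shows "\<exists>\<gamma>>0. \<exists>D::nat.
    (\<lambda>n. measure_pmf.prob (gnp n ((1 + \<epsilon>) / real n))
       {G. \<exists>H. induced_subgraph H G \<and> max_degree_le H D \<and> expander \<gamma> H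
             \<and> real (card (verts H)) \<ge> \<gamma> * real n}) \<longlonglongrightarrow> 1"
proof -
  define c where "c = 1 + \<epsilon>"
  have c: "c > 1" "c > 0" using assms by (auto simp: c_def)
  let ?P = "\<lambda>n. measure_pmf.prob (gnp n (c / real n))"
  let ?X1 = "\<lambda>(\<delta>::real) n. {G :: nat ugraph. \<not> (\<exists>A\<subseteq>verts G.
            real (card (edges_within (edges G) A)) \<ge> card A + \<delta> * real n)}"
  let ?X2 = "\<lambda>(\<nu>::real) (\<alpha>::real) n. {G :: nat ugraph. \<exists>W\<subseteq>verts G. W \<noteq> {} \<and> real (card W) \<le> \<alpha> * real n \<and>
            real (card (edges_within (edges G) W)) \<ge> (1 + \<nu>) * card W}"
  let ?X3 = "\<lambda>(\<delta>::real) (\<mu>::real) n. {G :: nat ugraph. \<exists>S\<subseteq>verts G. real (card S) \<le> \<mu> * real n + 1 \<and>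
            real (card {e \<in> edges G. e \<inter> S \<noteq> {}}) \<ge> \<delta> / 2 * real n}"
  obtain \<delta> where \<delta>: "\<delta> > 0" and P1: "(\<lambda>n. ?P n (?X1 \<delta> n)) \<longlonglongrightarrow> 0"
    using gnp_dense_subset[OF c(1)] by blast
  define \<nu> where "\<nu> = min 1 (\<delta> / 4)"
  have \<nu>: "0 < \<nu>" "\<nu> \<le> 1" "\<nu> \<le> \<delta> / 4" using \<delta> by (auto simp: \<nu>_def)
  obtain \<alpha> where \<alpha>: "\<alpha> > 0" and P2: "(\<lambda>n. ?P n (?X2 \<nu> \<alpha> n)) \<longlonglongrightarrow> 0"
    using gnp_locally_sparse[OF c(2) \<nu>(1,2)] by blast
  have "\<delta> / 2 > 0" using \<delta> by simp
  then obtain \<mu> where \<mu>: "\<mu> > 0" and P3: "(\<lambda>n. ?P n (?X3 \<delta> \<mu> n)) \<longlonglongrightarrow> 0"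
    using gnp_few_edges_at_small_sets[OF c(2)] by blast
  \<comment> \<open>The constants are chosen in the order \<open>\<delta>\<close>,
    \<open>\<nu>\<close>, \<open>\<alpha>\<close>, \<open>\<mu>\<close>, \<open>D\<close>, each from
    the previous ones and \<open>c\<close> alone, so the degree bound does not depend on
    \<open>n\<close>.\<close>
  define D where "D = nat \<lceil>\<delta> / \<mu>\<rceil> + 1"
  have D: "D > 0" by (simp add: D_def)
  have "\<delta> / \<mu> \<le> real D" unfolding D_def using \<delta> \<mu> by (simp add: of_nat_nat) linarith
  then have D\<mu>: "\<delta> \<le> \<mu> * D" using \<mu> by (simp add: field_simps)
  \<comment> \<open>The same constant serves for the expansion and for the size:
    \<open>\<nu> \<le> 1 \<le> D\<close> gives \<open>\<gamma> \<le> \<alpha>\<close>.\<close>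
  define \<gamma> where "\<gamma> = \<nu> * \<alpha> / D"
  have \<gamma>: "\<gamma> > 0" using \<nu> \<alpha> D by (simp add: \<gamma>_def)
  have "\<nu> * \<alpha> \<le> D * \<alpha>" using \<nu> \<alpha> D by (intro mult_right_mono) auto
  then have \<gamma>\<alpha>: "\<gamma> \<le> \<alpha>" using D by (simp add: \<gamma>_def field_simps)
  let ?good = "\<lambda>n. {G :: nat ugraph. \<exists>H. induced_subgraph H G \<and> max_degree_le H D \<and> expander \<gamma> H
             \<and> real (card (verts H)) \<ge> \<gamma> * real n}"
  have lower: "1 - (?P n (?X1 \<delta> n) + ?P n (?X2 \<nu> \<alpha> n) + ?P n (?X3 \<delta> \<mu> n)) \<le> ?P n (?good n)" if n: "n > 0" for n
  proof -
    \<comment> \<open>A graph in the support that avoids the three exceptional events satisfies all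
      hypotheses of the deterministic lemma, hence is good.\<close>
    have "?P n UNIV \<le> ?P n (?good n \<union> (?X1 \<delta> n \<union> ?X2 \<nu> \<alpha> n \<union> ?X3 \<delta> \<mu> n))"
    proof (intro measure_pmf.finite_measure_mono_AE AE_pmfI impI)
      fix G assume "G \<in> set_pmf (gnp n (c / real n))"
      then obtain E where E: "E \<subseteq> all_pairs {..<n}" "G = ({..<n}, E)" by (rule set_pmf_gnpE)
      show "G \<in> ?good n \<union> (?X1 \<delta> n \<union> ?X2 \<nu> \<alpha> n \<union> ?X3 \<delta> \<mu> n)"
      proof (rule ccontr)
        assume bad: "G \<notin> ?good n \<union> (?X1 \<delta> n \<union> ?X2 \<nu> \<alpha> n \<union> ?X3 \<delta> \<mu> n)"
        then have "G \<notin> ?X1 \<delta> n" by blast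
        then obtain A where A: "A \<subseteq> {..<n}" "real (card (edges_within E A)) \<ge> card A + \<delta> * real n"
          using E(2) by auto
        have "\<exists>H. induced_subgraph H ({..<n}, E) \<and> max_degree_le H D \<and> expander (\<nu> * \<alpha> / D) H
           \<and> real (card (verts H)) \<ge> \<alpha> * card {..<n}"
        proof (rule expander_in_typical_graph[where A = A and \<delta> = \<delta> and \<mu> = \<mu>])
          show "real (card {e \<in> E. e \<inter> S \<noteq> {}}) < \<delta> / 2 * real (card {..<n})"
            if "S \<subseteq> {..<n}" "real (card S) \<le> \<mu> * real (card {..<n}) + 1" for S
          proof -
            have "G \<notin> ?X3 \<delta> \<mu> n" using bad by blast
            then have "\<not> (\<exists>S\<subseteq>{..<n}. real (card S) \<le> \<mu> * real n + 1 \<and>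
                real (card {e \<in> E. e \<inter> S \<noteq> {}}) \<ge> \<delta> / 2 * real n)" using E(2) by simp
            then show ?thesis using that unfolding card_lessThan not_le[symmetric] by blast
          qed
          show "real (card (edges_within E W)) < (1 + \<nu>) * card W"
            if "W \<subseteq> {..<n}" "W \<noteq> {}" "real (card W) \<le> \<alpha> * card {..<n}" for W
          proof -
            have "G \<notin> ?X2 \<nu> \<alpha> n" using bad by blast
            then have "\<not> (\<exists>W\<subseteq>{..<n}. W \<noteq> {} \<and> real (card W) \<le> \<alpha> * real n \<and>
                real (card (edges_within E W)) \<ge> (1 + \<nu>) * card W)" using E(2) by simp
            then show ?thesis using that unfolding card_lessThan not_le[symmetric] by blast
          qed
        qed (use E A \<delta> \<mu> \<nu> \<alpha> D D\<mu> n in auto)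
        then obtain H where "induced_subgraph H G" "max_degree_le H D" "expander \<gamma> H"
          "real (card (verts H)) \<ge> \<alpha> * n" using E(2) by (auto simp: \<gamma>_def)
        moreover have "\<alpha> * n \<ge> \<gamma> * n" using \<gamma>\<alpha> by (intro mult_right_mono) auto
        ultimately have "G \<in> ?good n" using order_trans by blast
        with bad show False by blast
      qed
    qed simp
    moreover have "?P n (?good n \<union> (?X1 \<delta> n \<union> ?X2 \<nu> \<alpha> n \<union> ?X3 \<delta> \<mu> n))
        \<le> ?P n (?good n) + ?P n (?X1 \<delta> n \<union> ?X2 \<nu> \<alpha> n \<union> ?X3 \<delta> \<mu> n)"
      by (rule measure_Un_le) auto
    moreover have "?P n (?X1 \<delta> n \<union> ?X2 \<nu> \<alpha> n \<union> ?X3 \<delta> \<mu> n) \<le> ?P n (?X1 \<delta> n \<union> ?X2 \<nu> \<alpha> n) + ?P n (?X3 \<delta> \<mu> n)"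
      by (rule measure_Un_le) auto
    moreover have "?P n (?X1 \<delta> n \<union> ?X2 \<nu> \<alpha> n) \<le> ?P n (?X1 \<delta> n) + ?P n (?X2 \<nu> \<alpha> n)"
      by (rule measure_Un_le) auto
    moreover have "?P n UNIV = 1" by simp
    ultimately show ?thesis by linarith
  qed
  have "(\<lambda>n. 1 - (?P n (?X1 \<delta> n) + ?P n (?X2 \<nu> \<alpha> n) + ?P n (?X3 \<delta> \<mu> n))) \<longlonglongrightarrow> 1 - (0 + 0 + 0)"
    by (intro tendsto_intros P1 P2 P3)
  then have lim: "(\<lambda>n. 1 - (?P n (?X1 \<delta> n) + ?P n (?X2 \<nu> \<alpha> n) + ?P n (?X3 \<delta> \<mu> n))) \<longlonglongrightarrow> 1" by simp
  have "(\<lambda>n. ?P n (?good n)) \<longlonglongrightarrow> 1"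
  proof (rule tendsto_sandwich[OF _ _ lim tendsto_const])
    show "\<forall>\<^sub>F n in sequentially. 1 - (?P n (?X1 \<delta> n) + ?P n (?X2 \<nu> \<alpha> n) + ?P n (?X3 \<delta> \<mu> n)) \<le> ?P n (?good n)"
      using eventually_gt_at_top[of 0] by (rule eventually_mono) (rule lower)
  qed (simp add: measure_pmf.prob_le_1)
  then show ?thesis using \<gamma> unfolding c_def by blast
qed

end
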